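(* Let $F_2$ be the free group on two generators and let $G$ be Grigorchuk's group of intermediate volume growth. Then the group $(\mathbb{Z}\wr F_2)\times G$ has subexponential decomposition growth.
   Context: For groups $A,H$, let $F(H;A)$ be the group (under pointwise multiplication) of finitely supported functions $H\to A$, identified with $\bigoplus_{h\in H}A$; $H$ acts on it by $(hf)(h')=f(h^{-1}h')$, and the wreath product is $A\wr H=F(H;A)\rtimes H$. Grigorchuk's group is the (first) Grigorchuk group: the group of automorphisms of the infinite rooted binary tree $\{0,1\}^*$ generated by $a,b,c,d$, where $a$ flips the first letter of each nonempty word, and, recursively, for words $w$: $b(0w)=0\,a(w)$, $b(1w)=1\,c(w)$; $c(0w)=0\,a(w)$, $c(1w)=1\,d(w)$; $d(0w)=0w$, $d(1w)=1\,b(w)$. A finitely generated group is regarded as a metric space with a word length metric $d(g,h)=|g^{-1}h|_S$, where $S$ is a finite symmetric generating set and $|g|_S$ is the length of a shortest word in $S$ representing $g$. $\mathbb{R}^+$ denotes the positive reals. For nonempty subsets $A,B$ of a metric space, $d(A,B)=\inf\{d(a,b):a\in A,b\in B\}$. For $R>0$, a family $\mathcal{U}$ of nonempty subsets of a metric space is $R$-disjoint if $d(A,B)>R$ for all $A,B\in\mathcal{U}$ with $A\neq B$. A metric family is a family of metric spaces (subsets of a metric space carry the restricted metric); it is uniformly bounded if the supremum of the diameters of its members is finite. A metric space $X$ $(R,n)$-decomposes over a metric family $\mathcal{V}$, written $X\stackrel{R,n}{\longrightarrow}\mathcal{V}$, if there is a family $\mathcal{U}=\mathcal{U}_1\cup\dots\cup\mathcal{U}_n$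 of subsets of $X$ covering $X$ such that each $\mathcal{U}_i$ is $R$-disjoint and $\mathcal{U}\subset\mathcal{V}$. For metric families, $\mathcal{U}\stackrel{R,n}{\longrightarrow}\mathcal{V}$ means that every member of $\mathcal{U}$ $(R,n)$-decomposes over $\mathcal{V}$. A non-decreasing function $s:\mathbb{R}^+\to\mathbb{N}$ is a decomposition complexity growth function for a metric space $X$ if for every sequence $R_1\le R_2\le\cdots$ of positive reals there exist a positive integer $n$ and metric families $\mathcal{V}_1,\dots,\mathcal{V}_n$ with $$X\stackrel{R_1,s(R_1)}{\longrightarrow}\mathcal{V}_1\stackrel{R_2,s(R_2)}{\longrightarrow}\mathcal{V}_2\stackrel{R_3,s(R_3)}{\longrightarrow}\cdots\stackrel{R_n,s(R_n)}{\longrightarrow}\mathcal{V}_n$$ and $\mathcal{V}_n$ uniformly bounded. Non-decreasing $s,t:\mathbb{R}^+\to\mathbb{N}$ have the same growth if there are constants $a,c>0$ such that $s(ax)\ge t(x)-c$ and $t(ax)\ge s(x)-c$ for all $x>0$. A non-decreasing $s:\mathbb{R}^+\to\mathbb{N}$ is subexponential if $\lim_{x\to\infty}s(x)^{1/x}=1$. A metric space has subexponential decomposition growth if it has a decomposition complexity growth function that has the same growth as some subexponential function. *)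

theory Defs
  imports "HOL-Analysis.Analysis" "HOL-Algebra.Bij" "HOL-Algebra.Product_Groups"
begin

section \<open>Decomposition complexity of metric spaces\<close>

text \<open>Metric spaces are elements of the library type \<^typ>\<open>'a metric\<close>, and metric families are sets
  of these. A subset \<open>A\<close> of \<open>X\<close> is regarded as the metric space \<^term>\<open>submetric X A\<close>.\<close>

definition set_mdist :: "'a metric \<Rightarrow> 'a set \<Rightarrow> 'a set \<Rightarrow> real" where
  "set_mdist X A B = Inf {mdist X a b |a b. a \<in> A \<and> b \<in> B}"

definition R_disjoint :: "'a metric \<Rightarrow> real \<Rightarrow> 'a set set \<Rightarrow> bool" where
  "R_disjoint X R \<U> \<longleftrightarrow>
     (\<forall>A\<in>\<U>. A \<noteq> {} \<and> A \<subseteq> mspace X) \<and>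
     (\<forall>A\<in>\<U>. \<forall>B\<in>\<U>. A \<noteq> B \<longrightarrow> set_mdist X A B > R)"

definition decomposes_over :: "'a metric \<Rightarrow> real \<Rightarrow> nat \<Rightarrow> 'a metric set \<Rightarrow> bool" where
  "decomposes_over X R n \<V> \<longleftrightarrow>
     (\<exists>\<U> :: nat \<Rightarrow> 'a set set.
        (\<forall>i\<in>{1..n}. R_disjoint X R (\<U> i)) \<and>
        \<Union> (\<Union>i\<in>{1..n}. \<U> i) = mspace X \<and>
        submetric X ` (\<Union>i\<in>{1..n}. \<U> i) \<subseteq> \<V>)"

definition family_decomposes_over :: "'a metric set \<Rightarrow> real \<Rightarrow> nat \<Rightarrow> 'a metric set \<Rightarrow> bool" where
  "family_decomposes_over \<W> R n \<V> \<longleftrightarrow> (\<forall>X\<in>\<W>. decomposes_over X R n \<V>)"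

definition metric_diameter :: "'a metric \<Rightarrow> ennreal" where
  "metric_diameter X = (SUP x\<in>mspace X. SUP y\<in>mspace X. ennreal (mdist X x y))"

definition uniformly_bounded :: "'a metric set \<Rightarrow> bool" where
  "uniformly_bounded \<V> \<longleftrightarrow> (SUP X\<in>\<V>. metric_diameter X) < \<infinity>"

text \<open>A function on the positive reals is a function on all reals whose values outside
  \<^term>\<open>{0<..} :: real set\<close> are never used.\<close>

definition decomposition_growth_function :: "'a metric \<Rightarrow> (real \<Rightarrow> nat) \<Rightarrow> bool" where
  "decomposition_growth_function X s \<longleftrightarrow>
     mono_on {0<..} s \<and>
     (\<forall>R :: nat \<Rightarrow> real. (\<forall>i\<ge>1. 0 < R i \<and> R i \<le> R (Suc i)) \<longrightarrow>
        (\<exists>n\<ge>1. \<exists>\<V> :: nat \<Rightarrow> 'a metric set.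
           \<V> 0 = {X} \<and>
           (\<forall>i\<in>{1..n}. family_decomposes_over (\<V> (i - 1)) (R i) (s (R i)) (\<V> i)) \<and>
           uniformly_bounded (\<V> n)))"

definition same_growth :: "(real \<Rightarrow> nat) \<Rightarrow> (real \<Rightarrow> nat) \<Rightarrow> bool" where
  "same_growth s t \<longleftrightarrow>
     (\<exists>a c :: real. a > 0 \<and> c > 0 \<and>
        (\<forall>x>0. real (s (a * x)) \<ge> real (t x) - c \<and> real (t (a * x)) \<ge> real (s x) - c))"

definition subexponential :: "(real \<Rightarrow> nat) \<Rightarrow> bool" where
  "subexponential s \<longleftrightarrow>
     mono_on {0<..} s \<and> ((\<lambda>x. real (s x) powr (1 / x)) \<longlongrightarrow> 1) at_top"

definition subexponential_decomposition_growth :: "'a metric \<Rightarrow> bool" where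
  "subexponential_decomposition_growth X \<longleftrightarrow>
     (\<exists>s t. decomposition_growth_function X s \<and> subexponential t \<and> same_growth s t)"


section \<open>Word metrics\<close>

definition finite_symmetric_generating_set :: "('a, 'b) monoid_scheme \<Rightarrow> 'a set \<Rightarrow> bool" where
  "finite_symmetric_generating_set G S \<longleftrightarrow>
     finite S \<and> S \<subseteq> carrier G \<and> (\<forall>x\<in>S. inv\<^bsub>G\<^esub> x \<in> S) \<and> generate G S = carrier G"

definition word_length :: "('a, 'b) monoid_scheme \<Rightarrow> 'a set \<Rightarrow> 'a \<Rightarrow> nat" where
  "word_length G S g =
     (LEAST n. \<exists>w. set w \<subseteq> S \<and> length w = n \<and> foldr (\<otimes>\<^bsub>G\<^esub>) w \<one>\<^bsub>G\<^esub> = g)"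

text \<open>The library requires the distance function of a metric space to be symmetric and nonnegative
  even off the carrier; hence the value 0 there.\<close>

definition word_dist :: "('a, 'b) monoid_scheme \<Rightarrow> 'a set \<Rightarrow> 'a \<Rightarrow> 'a \<Rightarrow> real" where
  "word_dist G S g h =
     (if g \<in> carrier G \<and> h \<in> carrier G then real (word_length G S (inv\<^bsub>G\<^esub> g \<otimes>\<^bsub>G\<^esub> h)) else 0)"

definition word_metric :: "('a, 'b) monoid_scheme \<Rightarrow> 'a set \<Rightarrow> 'a metric" where
  "word_metric G S = metric (carrier G, word_dist G S)"

context group
begin

lemma foldr_mult_closed: "set w \<subseteq> carrier G \<Longrightarrow> foldr (\<otimes>) w \<one> \<in> carrier G"
  by (induction w) auto

lemma foldr_mult_append:
  "set u \<subseteq> carrier G \<Longrightarrow> set v \<subseteq> carrier G \<Longrightarrow>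
     foldr (\<otimes>) (u @ v) \<one> = foldr (\<otimes>) u \<one> \<otimes> foldr (\<otimes>) v \<one>"
  by (induction u) (auto simp: m_assoc foldr_mult_closed)

lemma foldr_mult_inv:
  "set u \<subseteq> carrier G \<Longrightarrow>
     foldr (\<otimes>) (rev (map (\<lambda>x. inv x) u)) \<one> = inv (foldr (\<otimes>) u \<one>)"
proof (induction u)
  case (Cons a u)
  then show ?case
    by (subst list.map, subst rev.simps, subst foldr_mult_append)
       (auto simp: inv_mult_group foldr_mult_closed)
qed auto

lemma ex_word:
  assumes "finite_symmetric_generating_set G S" and "g \<in> carrier G"
  shows "\<exists>w. set w \<subseteq> S \<and> foldr (\<otimes>) w \<one> = g"
proof -
  have S: "S \<subseteq> carrier G" "\<And>x. x \<in> S \<Longrightarrow> inv x \<in> S"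
    using assms by (auto simp: finite_symmetric_generating_set_def)
  have "g \<in> generate G S"
    using assms by (auto simp: finite_symmetric_generating_set_def)
  then show ?thesis
  proof induction
    case one
    show ?case by (intro exI[of _ "[]"]) auto
  next
    case (incl h)
    then show ?case using S by (intro exI[of _ "[h]"]) auto
  next
    case (inv h)
    then show ?case using S by (intro exI[of _ "[inv h]"]) auto
  next
    case (eng h1 h2)
    then obtain u v where "set u \<subseteq> S" "foldr (\<otimes>) u \<one> = h1" "set v \<subseteq> S" "foldr (\<otimes>) v \<one> = h2"
      by blast
    then show ?case using S(1)
      by (intro exI[of _ "u @ v"]) (subst foldr_mult_append, auto)
  qed
qed

lemma word_length_attained:
  assumes "finite_symmetric_generating_set G S" and "g \<in> carrier G"
  obtains w where "set w \<subseteq> S" "length w = word_length G S g" "foldr (\<otimes>) w \<one> = g"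
proof -
  have "\<exists>n w. set w \<subseteq> S \<and> length w = n \<and> foldr (\<otimes>) w \<one> = g"
    using ex_word[OF assms] by blast
  from LeastI_ex[OF this] show thesis
    using that unfolding word_length_def by blast
qed

lemma word_length_le: "set w \<subseteq> S \<Longrightarrow> foldr (\<otimes>) w \<one> = g \<Longrightarrow> word_length G S g \<le> length w"
  unfolding word_length_def by (rule Least_le) blast

lemma word_length_eq_0_iff:
  assumes "finite_symmetric_generating_set G S" and "g \<in> carrier G"
  shows "word_length G S g = 0 \<longleftrightarrow> g = \<one>"
proof
  assume "word_length G S g = 0"
  with word_length_attained[OF assms] show "g = \<one>" by fastforce
next
  assume "g = \<one>"
  then show "word_length G S g = 0" using word_length_le[of "[]" S g] by simp
qed

lemma word_length_inv_le:
  assumes gen: "finite_symmetric_generating_set G S" and g: "g \<in> carrier G"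
  shows "word_length G S (inv g) \<le> word_length G S g"
proof -
  obtain w where w: "set w \<subseteq> S" "length w = word_length G S g" "foldr (\<otimes>) w \<one> = g"
    using word_length_attained[OF gen g] .
  have S: "S \<subseteq> carrier G" "\<And>x. x \<in> S \<Longrightarrow> inv x \<in> S"
    using gen by (auto simp: finite_symmetric_generating_set_def)
  have "foldr (\<otimes>) (rev (map (\<lambda>x. inv x) w)) \<one> = inv g"
    using foldr_mult_inv[of w] w S by auto
  moreover have "set (rev (map (\<lambda>x. inv x) w)) \<subseteq> S" using w S by auto
  ultimately show ?thesis
    using word_length_le[of "rev (map (\<lambda>x. inv x) w)" S "inv g"] w by simp
qed

lemma word_length_mult_le:
  assumes gen: "finite_symmetric_generating_set G S" and g: "g \<in> carrier G" and h: "h \<in> carrier G"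
  shows "word_length G S (g \<otimes> h) \<le> word_length G S g + word_length G S h"
proof -
  obtain u where u: "set u \<subseteq> S" "length u = word_length G S g" "foldr (\<otimes>) u \<one> = g"
    using word_length_attained[OF gen g] .
  obtain v where v: "set v \<subseteq> S" "length v = word_length G S h" "foldr (\<otimes>) v \<one> = h"
    using word_length_attained[OF gen h] .
  have S: "S \<subseteq> carrier G"
    using gen by (auto simp: finite_symmetric_generating_set_def)
  have "foldr (\<otimes>) (u @ v) \<one> = g \<otimes> h"
    using foldr_mult_append[of u v] u v S by blast
  then show ?thesis
    using word_length_le[of "u @ v" S "g \<otimes> h"] u v by simp
qed

lemma Metric_space_word_dist:
  assumes gen: "finite_symmetric_generating_set G S"
  shows "Metric_space (carrier G) (word_dist G S)"
proof
  show "0 \<le> word_dist G S x y" for x y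
    by (simp add: word_dist_def)
  have le: "word_length G S (inv x \<otimes> y) \<le> word_length G S (inv y \<otimes> x)"
    if "x \<in> carrier G" "y \<in> carrier G" for x y
    using word_length_inv_le[OF gen, of "inv y \<otimes> x"] that by (simp add: inv_mult_group)
  show "word_dist G S x y = word_dist G S y x" for x y
    using le[of x y] le[of y x] by (auto simp: word_dist_def)
  show "word_dist G S x y = 0 \<longleftrightarrow> x = y" if xy: "x \<in> carrier G" "y \<in> carrier G" for x y
  proof -
    have "inv x \<otimes> y = \<one> \<longleftrightarrow> x = y"
      using xy by (metis inv_closed inv_equality inv_inv l_inv)
    then show ?thesis
      using xy word_length_eq_0_iff[OF gen, of "inv x \<otimes> y"] by (simp add: word_dist_def)
  qed
  show "word_dist G S x z \<le> word_dist G S x y + word_dist G S y z"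
    if xyz: "x \<in> carrier G" "y \<in> carrier G" "z \<in> carrier G" for x y z
  proof -
    have "(inv x \<otimes> y) \<otimes> (inv y \<otimes> z) = inv x \<otimes> z"
      using xyz by (simp add: m_assoc) (simp add: m_assoc[symmetric])
    then show ?thesis
      using xyz word_length_mult_le[OF gen, of "inv x \<otimes> y" "inv y \<otimes> z"]
      by (simp add: word_dist_def flip: of_nat_add)
  qed
qed

lemma
  assumes "finite_symmetric_generating_set G S"
  shows mspace_word_metric: "mspace (word_metric G S) = carrier G"
    and mdist_word_metric: "mdist (word_metric G S) = word_dist G S"
proof -
  interpret Metric_space "carrier G" "word_dist G S"
    using Metric_space_word_dist[OF assms] .
  show "mspace (word_metric G S) = carrier G" "mdist (word_metric G S) = word_dist G S"
    by (simp_all add: word_metric_def)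
qed

end


section \<open>Free groups\<close>

text \<open>The free group on \<open>X\<close> consists of the reduced words; the letter \<open>(x, True)\<close> stands for \<open>x\<close> and
  \<open>(x, False)\<close> for its inverse.\<close>

definition letter_inv :: "'a \<times> bool \<Rightarrow> 'a \<times> bool" where
  "letter_inv l = (fst l, \<not> snd l)"

fun reduced_word :: "('a \<times> bool) list \<Rightarrow> bool" where
  "reduced_word (l # m # w) \<longleftrightarrow> m \<noteq> letter_inv l \<and> reduced_word (m # w)"
| "reduced_word _ \<longleftrightarrow> True"

fun cancel_Cons :: "'a \<times> bool \<Rightarrow> ('a \<times> bool) list \<Rightarrow> ('a \<times> bool) list" where
  "cancel_Cons l [] = [l]"
| "cancel_Cons l (m # w) = (if m = letter_inv l then w else l # m # w)"

definition free_group :: "'a set \<Rightarrow> ('a \<times> bool) list monoid" where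
  "free_group X =
     \<lparr>carrier = {w \<in> lists (X \<times> UNIV). reduced_word w},
      monoid.mult = (\<lambda>u v. foldr cancel_Cons u v),
      one = []\<rparr>"

definition F2 :: "(nat \<times> bool) list monoid" where
  "F2 = free_group {0, 1}"

lemma letter_inv_letter_inv [simp]: "letter_inv (letter_inv l) = l"
  by (simp add: letter_inv_def)

lemma letter_inv_neq: "letter_inv l \<noteq> l"
  by (metis letter_inv_def snd_conv)

lemma letter_inv_mem: "l \<in> X \<times> UNIV \<Longrightarrow> letter_inv l \<in> X \<times> UNIV"
  by (auto simp: letter_inv_def)

lemma reduced_word_tl: "reduced_word (l # w) \<Longrightarrow> reduced_word w"
  by (cases w) auto

lemma reduced_cancel_Cons: "reduced_word w \<Longrightarrow> reduced_word (cancel_Cons l w)"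
  by (cases w) (auto intro: reduced_word_tl)

lemma cancel_Cons_reduced: "reduced_word (l # w) \<Longrightarrow> cancel_Cons l w = l # w"
  by (cases w) auto

lemma cancel_Cons_cancel_Cons:
  "reduced_word w \<Longrightarrow> cancel_Cons l (cancel_Cons (letter_inv l) w) = w"
  by (cases w) (auto simp: cancel_Cons_reduced)

lemma reduced_foldr_cancel_Cons: "reduced_word w \<Longrightarrow> reduced_word (foldr cancel_Cons u w)"
  by (induction u) (auto intro: reduced_cancel_Cons)

lemma cancel_Cons_lists: "l \<in> A \<Longrightarrow> w \<in> lists A \<Longrightarrow> cancel_Cons l w \<in> lists A"
  by (cases w) auto

lemma foldr_cancel_Cons_lists:
  "u \<in> lists A \<Longrightarrow> w \<in> lists A \<Longrightarrow> foldr cancel_Cons u w \<in> lists A"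
proof (induction u)
  case (Cons l u)
  then have "l \<in> A" "foldr cancel_Cons u w \<in> lists A" by auto
  then show ?case using cancel_Cons_lists[of l A] by simp
qed auto

lemma foldr_cancel_Cons_Nil: "reduced_word w \<Longrightarrow> foldr cancel_Cons w [] = w"
proof (induction w)
  case (Cons l w)
  then show ?case using reduced_word_tl[of l w] cancel_Cons_reduced[of l w] by simp
qed simp

lemma foldr_cancel_Cons_assoc:
  assumes "reduced_word v" "reduced_word w"
  shows "foldr cancel_Cons (foldr cancel_Cons u v) w =
         foldr cancel_Cons u (foldr cancel_Cons v w)"
proof (induction u)
  case (Cons l u)
  have *: "foldr cancel_Cons (cancel_Cons l v') w = cancel_Cons l (foldr cancel_Cons v' w)" for v'
    using assms
    by (cases v') (auto simp: cancel_Cons_cancel_Cons reduced_foldr_cancel_Cons)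
  show ?case using Cons by (simp add: *)
qed simp

lemma foldr_cancel_Cons_inverse:
  "reduced_word u \<Longrightarrow> foldr cancel_Cons (rev (map letter_inv u)) u = []"
  by (induction u) (auto dest: reduced_word_tl)

lemma group_free_group: "group (free_group X)"
proof (rule groupI)
  fix u assume "u \<in> carrier (free_group X)"
  then have u: "u \<in> lists (X \<times> UNIV)" "reduced_word u" by (auto simp: free_group_def)
  let ?v = "foldr cancel_Cons (rev (map letter_inv u)) []"
  have "?v \<in> lists (X \<times> UNIV)"
    by (rule foldr_cancel_Cons_lists) (use u in \<open>(fastforce simp: letter_inv_def)+\<close>)
  moreover have "reduced_word ?v" by (rule reduced_foldr_cancel_Cons) simp
  moreover have "foldr cancel_Cons ?v u = []"
    using u by (subst foldr_cancel_Cons_assoc) (auto simp: foldr_cancel_Cons_inverse)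
  ultimately show "\<exists>v\<in>carrier (free_group X). v \<otimes>\<^bsub>free_group X\<^esub> u = \<one>\<^bsub>free_group X\<^esub>"
    unfolding free_group_def by auto
qed (auto simp: free_group_def foldr_cancel_Cons_lists reduced_foldr_cancel_Cons
       foldr_cancel_Cons_assoc simp del: in_lists_conv_set)


section \<open>Wreath products\<close>

definition semidirect_product ::
    "('a, 'c) monoid_scheme \<Rightarrow> ('b, 'd) monoid_scheme \<Rightarrow> ('b \<Rightarrow> 'a \<Rightarrow> 'a) \<Rightarrow> ('a \<times> 'b) monoid" where
  "semidirect_product N H \<phi> =
     \<lparr>carrier = carrier N \<times> carrier H,
      monoid.mult = (\<lambda>(n, h) (n', h'). (n \<otimes>\<^bsub>N\<^esub> \<phi> h n', h \<otimes>\<^bsub>H\<^esub> h')),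
      one = (\<one>\<^bsub>N\<^esub>, \<one>\<^bsub>H\<^esub>)\<rparr>"

text \<open>The group of finitely supported functions from \<open>H\<close> to \<open>A\<close> under pointwise multiplication is
  the library's \<^term>\<open>sum_group (carrier H) (\<lambda>_. A)\<close>, whose elements are extensional functions
  on \<^term>\<open>carrier H\<close> (hence the \<^const>\<open>restrict\<close> in the action).\<close>

definition shift_action :: "('b, 'd) monoid_scheme \<Rightarrow> 'b \<Rightarrow> ('b \<Rightarrow> 'a) \<Rightarrow> 'b \<Rightarrow> 'a" where
  "shift_action H h f = (\<lambda>x\<in>carrier H. f (inv\<^bsub>H\<^esub> h \<otimes>\<^bsub>H\<^esub> x))"

definition wreath_product ::
    "('a, 'c) monoid_scheme \<Rightarrow> ('b, 'd) monoid_scheme \<Rightarrow> (('b \<Rightarrow> 'a) \<times> 'b) monoid"  (infixr "wr" 75)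
  where "A wr H = semidirect_product (sum_group (carrier H) (\<lambda>_. A)) H (shift_action H)"

lemma group_semidirect_product:
  assumes "group N" "group H"
    and hom: "\<And>h. h \<in> carrier H \<Longrightarrow> \<phi> h \<in> hom N N"
    and one: "\<And>n. n \<in> carrier N \<Longrightarrow> \<phi> \<one>\<^bsub>H\<^esub> n = n"
    and mult: "\<And>h h' n. h \<in> carrier H \<Longrightarrow> h' \<in> carrier H \<Longrightarrow> n \<in> carrier N \<Longrightarrow>
                 \<phi> (h \<otimes>\<^bsub>H\<^esub> h') n = \<phi> h (\<phi> h' n)"
  shows "group (semidirect_product N H \<phi>)"
proof -
  interpret N: group N by fact
  interpret H: group H by fact
  have cl: "\<phi> h n \<in> carrier N" if "h \<in> carrier H" "n \<in> carrier N" for h n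
    using hom[OF that(1)] that(2) by (auto simp: hom_def)
  have dist: "\<phi> h (n \<otimes>\<^bsub>N\<^esub> n') = \<phi> h n \<otimes>\<^bsub>N\<^esub> \<phi> h n'"
    if "h \<in> carrier H" "n \<in> carrier N" "n' \<in> carrier N" for h n n'
    using hom[OF that(1)] that(2,3) by (auto simp: hom_def)
  show ?thesis
  proof (rule groupI)
    fix x assume "x \<in> carrier (semidirect_product N H \<phi>)"
    then obtain n h where x: "x = (n, h)" "n \<in> carrier N" "h \<in> carrier H"
      by (auto simp: semidirect_product_def)
    let ?y = "(\<phi> (inv\<^bsub>H\<^esub> h) (inv\<^bsub>N\<^esub> n), inv\<^bsub>H\<^esub> h)"
    have "\<phi> (inv\<^bsub>H\<^esub> h) (inv\<^bsub>N\<^esub> n) \<otimes>\<^bsub>N\<^esub> \<phi> (inv\<^bsub>H\<^esub> h) n = \<phi> (inv\<^bsub>H\<^esub> h) \<one>\<^bsub>N\<^esub>"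
      using x by (simp flip: dist)
    also have "\<dots> = \<one>\<^bsub>N\<^esub>"
      using hom_one[OF hom N.is_group N.is_group] x by auto
    finally show "\<exists>y\<in>carrier (semidirect_product N H \<phi>).
                    y \<otimes>\<^bsub>semidirect_product N H \<phi>\<^esub> x = \<one>\<^bsub>semidirect_product N H \<phi>\<^esub>"
      using x by (intro bexI[of _ ?y]) (auto simp: semidirect_product_def cl)
  qed (auto simp: semidirect_product_def cl dist one mult N.m_assoc H.m_assoc)
qed

lemma group_wreath_product:
  assumes "group A" "group H"
  shows "group (A wr H)"
proof -
  interpret A: group A by fact
  interpret H: group H by fact
  let ?N = "sum_group (carrier H) (\<lambda>_. A)"
  have car: "carrier ?N = {f \<in> carrier H \<rightarrow>\<^sub>E carrier A. finite {x \<in> carrier H. f x \<noteq> \<one>\<^bsub>A\<^esub>}}"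
    using assms by (simp add: carrier_sum_group)
  have cl: "shift_action H h f \<in> carrier ?N" if h: "h \<in> carrier H" and f: "f \<in> carrier ?N" for h f
  proof -
    have "{x \<in> carrier H. shift_action H h f x \<noteq> \<one>\<^bsub>A\<^esub>} \<subseteq>
          (\<lambda>x. h \<otimes>\<^bsub>H\<^esub> x) ` {x \<in> carrier H. f x \<noteq> \<one>\<^bsub>A\<^esub>}"
    proof
      fix x assume x: "x \<in> {x \<in> carrier H. shift_action H h f x \<noteq> \<one>\<^bsub>A\<^esub>}"
      then have "x = h \<otimes>\<^bsub>H\<^esub> (inv\<^bsub>H\<^esub> h \<otimes>\<^bsub>H\<^esub> x)" using h by (simp flip: H.m_assoc)
      then show "x \<in> (\<lambda>x. h \<otimes>\<^bsub>H\<^esub> x) ` {x \<in> carrier H. f x \<noteq> \<one>\<^bsub>A\<^esub>}"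
        using x h by (intro image_eqI[of _ _ "inv\<^bsub>H\<^esub> h \<otimes>\<^bsub>H\<^esub> x"]) (auto simp: shift_action_def)
    qed
    moreover have "finite {x \<in> carrier H. f x \<noteq> \<one>\<^bsub>A\<^esub>}" using f by (simp add: car)
    ultimately have "finite {x \<in> carrier H. shift_action H h f x \<noteq> \<one>\<^bsub>A\<^esub>}"
      by (meson finite_imageI finite_subset)
    moreover have "shift_action H h f \<in> carrier H \<rightarrow>\<^sub>E carrier A"
      using h f by (auto simp: shift_action_def car)
    ultimately show ?thesis by (simp add: car)
  qed
  show ?thesis
    unfolding wreath_product_def
  proof (rule group_semidirect_product)
    show "group ?N" using assms by simp
    show "shift_action H h \<in> hom ?N ?N" if "h \<in> carrier H" for h
    proof (rule homI)
      show "shift_action H h f \<in> carrier ?N" if "f \<in> carrier ?N" for f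
        using cl \<open>h \<in> carrier H\<close> that .
    qed (use that in \<open>auto simp: shift_action_def fun_eq_iff\<close>)
    show "shift_action H \<one>\<^bsub>H\<^esub> f = f" if "f \<in> carrier ?N" for f
      using that by (auto simp: shift_action_def car fun_eq_iff PiE_def extensional_def)
    show "shift_action H (h \<otimes>\<^bsub>H\<^esub> h') f = shift_action H h (shift_action H h' f)"
      if "h \<in> carrier H" "h' \<in> carrier H" "f \<in> carrier ?N" for h h' f
      using that by (auto simp: shift_action_def fun_eq_iff H.inv_mult_group H.m_assoc)
  qed (fact assms)
qed


section \<open>Grigorchuk's group\<close>

text \<open>The vertices of the infinite rooted binary tree are the words over the letters
  \<open>0 = False\<close> and \<open>1 = True\<close>; the root is the empty word and the children of \<open>v\<close> are the words
  \<open>v @ [x]\<close>.\<close>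

definition tree_automorphisms :: "(bool list \<Rightarrow> bool list) set" where
  "tree_automorphisms =
     {f \<in> Bij UNIV. f [] = [] \<and> (\<forall>v w. (\<exists>x. w = v @ [x]) \<longleftrightarrow> (\<exists>x. f w = f v @ [x]))}"

definition tree_Aut :: "(bool list \<Rightarrow> bool list) monoid" where
  "tree_Aut = BijGroup UNIV\<lparr>carrier := tree_automorphisms\<rparr>"

fun grig_a :: "bool list \<Rightarrow> bool list" where
  "grig_a [] = []"
| "grig_a (x # w) = (\<not> x) # w"

fun grig_b grig_c grig_d :: "bool list \<Rightarrow> bool list" where
  "grig_b [] = []"
| "grig_b (False # w) = False # grig_a w"
| "grig_b (True # w) = True # grig_c w"
| "grig_c [] = []"
| "grig_c (False # w) = False # grig_a w"
| "grig_c (True # w) = True # grig_d w"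
| "grig_d [] = []"
| "grig_d (False # w) = False # w"
| "grig_d (True # w) = True # grig_b w"

definition Grigorchuk_group :: "(bool list \<Rightarrow> bool list) monoid" where
  "Grigorchuk_group = subgroup_generated tree_Aut {grig_a, grig_b, grig_c, grig_d}"

lemma subgroup_tree_automorphisms: "subgroup tree_automorphisms (BijGroup UNIV)"
proof -
  interpret B: group "BijGroup (UNIV :: bool list set)" by (rule group_BijGroup)
  have Bij: "f \<in> Bij UNIV \<longleftrightarrow> bij f" for f :: "bool list \<Rightarrow> bool list"
    by (simp add: Bij_def)
  have mult: "f \<otimes>\<^bsub>BijGroup UNIV\<^esub> g = f \<circ> g" if "bij f" "bij g" for f g :: "bool list \<Rightarrow> bool list"
    using that by (simp add: BijGroup_def Bij compose_def fun_eq_iff)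
  have m_inv: "inv\<^bsub>BijGroup UNIV\<^esub> f = inv_into UNIV f" if "bij f" for f :: "bool list \<Rightarrow> bool list"
  proof (rule B.inv_equality)
    have "bij (inv_into UNIV f)" using that by (rule bij_imp_bij_inv)
    then show "inv_into UNIV f \<otimes>\<^bsub>BijGroup UNIV\<^esub> f = \<one>\<^bsub>BijGroup UNIV\<^esub>"
      using that by (subst mult) (auto simp: BijGroup_def bij_is_inj fun_eq_iff)
    show "f \<in> carrier (BijGroup UNIV)" "inv_into UNIV f \<in> carrier (BijGroup UNIV)"
      using that \<open>bij (inv_into UNIV f)\<close> by (simp_all add: BijGroup_def Bij)
  qed
  show ?thesis
  proof (rule B.subgroupI)
    show "tree_automorphisms \<subseteq> carrier (BijGroup UNIV)"
      by (auto simp: tree_automorphisms_def BijGroup_def)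
    have "(\<lambda>x. x) \<in> tree_automorphisms"
      by (auto simp: tree_automorphisms_def Bij bij_def)
    then show "tree_automorphisms \<noteq> {}" by blast
  next
    fix f assume f: "f \<in> tree_automorphisms"
    then have bij: "bij f" by (simp add: tree_automorphisms_def Bij)
    then have f_inv: "f (inv_into UNIV f v) = v" for v by (simp add: bij_is_surj surj_f_inv_f)
    have "inv_into UNIV f [] = []"
      using f bij by (metis (mono_tags, lifting) bij_inv_eq_iff mem_Collect_eq tree_automorphisms_def)
    moreover have "(\<exists>x. w = v @ [x]) \<longleftrightarrow> (\<exists>x. inv_into UNIV f w = inv_into UNIV f v @ [x])" for v w
    proof -
      have "(\<exists>x. w' = v' @ [x]) \<longleftrightarrow> (\<exists>x. f w' = f v' @ [x])" for v' w'
        using f by (simp add: tree_automorphisms_def)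
      from this[of "inv_into UNIV f w" "inv_into UNIV f v"] show ?thesis by (simp add: f_inv)
    qed
    ultimately show "inv\<^bsub>BijGroup UNIV\<^esub> f \<in> tree_automorphisms"
      using bij by (simp add: m_inv tree_automorphisms_def Bij bij_imp_bij_inv)
  next
    fix f g assume "f \<in> tree_automorphisms" "g \<in> tree_automorphisms"
    then show "f \<otimes>\<^bsub>BijGroup UNIV\<^esub> g \<in> tree_automorphisms"
      by (subst mult) (auto simp: tree_automorphisms_def Bij bij_comp)
  qed
qed

lemma group_tree_Aut: "group tree_Aut"
  unfolding tree_Aut_def by (rule group.subgroup_imp_group[OF group_BijGroup subgroup_tree_automorphisms])

lemma grig_involutions:
  "grig_a (grig_a w) = w" "grig_b (grig_b w) = w" "grig_c (grig_c w) = w" "grig_d (grig_d w) = w"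
proof -
  show a: "grig_a (grig_a w) = w" for w by (cases w) auto
  show "grig_b (grig_b w) = w" "grig_c (grig_c w) = w" "grig_d (grig_d w) = w"
    by (induction w and w and w rule: grig_b_grig_c_grig_d.induct) (auto simp: a)
qed

lemma grig_snoc:
  "\<exists>y. grig_a (v @ [x]) = grig_a v @ [y]"
  "\<exists>y. grig_b (v @ [x]) = grig_b v @ [y]"
  "\<exists>y. grig_c (v @ [x]) = grig_c v @ [y]"
  "\<exists>y. grig_d (v @ [x]) = grig_d v @ [y]"
proof -
  show a: "\<exists>y. grig_a (v @ [x]) = grig_a v @ [y]" for v by (cases v) auto
  show "\<exists>y. grig_b (v @ [x]) = grig_b v @ [y]"
    "\<exists>y. grig_c (v @ [x]) = grig_c v @ [y]"
    "\<exists>y. grig_d (v @ [x]) = grig_d v @ [y]"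
    by (induction v and v and v rule: grig_b_grig_c_grig_d.induct) (use a in \<open>auto; cases x; auto\<close>)+
qed

lemma grig_in_tree_Aut: "{grig_a, grig_b, grig_c, grig_d} \<subseteq> carrier tree_Aut"
proof -
  have *: "f \<in> carrier tree_Aut"
    if inv: "\<And>w. f (f w) = w" and snoc: "\<And>v x. \<exists>y. f (v @ [x]) = f v @ [y]" and nil: "f [] = []"
    for f :: "bool list \<Rightarrow> bool list"
  proof -
    have "bij f" by (rule involuntory_imp_bij) (rule inv)
    moreover have "(\<exists>x. w = v @ [x]) \<longleftrightarrow> (\<exists>x. f w = f v @ [x])" for v w
      using snoc inv by metis
    ultimately show ?thesis
      using nil by (simp add: tree_Aut_def tree_automorphisms_def Bij_def)
  qed
  show ?thesis
    using grig_involutions grig_snoc by (auto intro!: *)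
qed

lemma group_Grigorchuk_group: "group Grigorchuk_group"
  unfolding Grigorchuk_group_def by (rule group.group_subgroup_generated[OF group_tree_Aut])

end

theory Submission
  imports Defs
begin

text \<open>The growth function is \<open>s R = v R + 1\<close>, where \<open>v R\<close> counts the projections to Grigorchuk's group
  \<open>G\<close> of the elements of length at most \<open>R\<close>.

  Joining elements of \<open>G\<close> that differ by such a projection gives a graph of degree at most \<open>v R\<close>,
  so a greedy colouring with \<open>s R\<close> colours splits the product into cosets of the lamplighter group
  in a single step. After that two colours per step suffice: the free group, being a tree, is cut into
  bounded pieces; one step fixes the lamps outside a finite set of positions; and each of the finitely
  many remaining lamps is treated as a copy of the integers. By left invariance it is enough to follow
  one representative of each family up to translation.

  The function \<open>s\<close> is subexponential because \<open>G\<close> is. An element \<open>g\<close> is determined by its action on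
  the first level and its two sections, and for a suitable weighted length
  \<open>6 (\<bar>g\<^sub>0\<bar> + \<bar>g\<^sub>1\<bar>) \<le> 5 (\<bar>g\<bar> + 3)\<close>. Hence \<open>Z \<epsilon> = (\<Sum>g. exp (- \<epsilon> \<bar>g\<bar>))\<close> satisfies
  \<open>Z \<epsilon> \<le> 2 exp (3 \<epsilon>) (Z (6 \<epsilon> / 5))\<^sup>2\<close>, so that finiteness for large \<open>\<epsilon>\<close> propagates to every
  \<open>\<epsilon> > 0\<close>.\<close>

section \<open>Decompositions into subsets of translates\<close>

definition word_ball :: "('a, 'b) monoid_scheme \<Rightarrow> 'a set \<Rightarrow> real \<Rightarrow> 'a set" where
  "word_ball G S R = {x \<in> carrier G. real (word_length G S x) \<le> R}"

text \<open>Closed under left translation and under passing to subsets, so a decomposition of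
  \<open>B\<close> alone serves every member. Each member carries the restricted word metric of the
  whole group, so repeated restriction causes no change of metric.\<close>

definition translate_family :: "('a, 'b) monoid_scheme \<Rightarrow> 'a set \<Rightarrow> 'a set \<Rightarrow> 'a metric set" where
  "translate_family G S B =
     {submetric (word_metric G S) A |A x. x \<in> carrier G \<and> A \<subseteq> (\<lambda>y. x \<otimes>\<^bsub>G\<^esub> y) ` B}"

context group
begin

lemma finite_word_ball:
  assumes gen: "finite_symmetric_generating_set G S"
  shows "finite (word_ball G S R)"
proof -
  have "word_ball G S R \<subseteq> (\<lambda>w. foldr (\<otimes>) w \<one>) ` {w. set w \<subseteq> S \<and> length w \<le> nat \<lfloor>R\<rfloor>}"
  proof
    fix x assume x: "x \<in> word_ball G S R"
    then obtain w where "set w \<subseteq> S" "length w = word_length G S x" "foldr (\<otimes>) w \<one> = x"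
      using word_length_attained[OF gen] by (auto simp: word_ball_def)
    moreover have "word_length G S x \<le> nat \<lfloor>R\<rfloor>"
      using x by (auto simp: word_ball_def le_nat_floor)
    ultimately show "x \<in> (\<lambda>w. foldr (\<otimes>) w \<one>) ` {w. set w \<subseteq> S \<and> length w \<le> nat \<lfloor>R\<rfloor>}"
      by force
  qed
  moreover have "finite {w. set w \<subseteq> S \<and> length w \<le> nat \<lfloor>R\<rfloor>}"
    using gen by (intro finite_lists_length_le) (simp add: finite_symmetric_generating_set_def)
  ultimately show ?thesis by (meson finite_imageI finite_subset)
qed

lemma one_in_word_ball: "0 \<le> R \<Longrightarrow> \<one> \<in> word_ball G S R"
  using word_length_le[of "[]" S \<one>] by (simp add: word_ball_def)

lemma inv_in_word_ball:
  "finite_symmetric_generating_set G S \<Longrightarrow> x \<in> word_ball G S R \<Longrightarrow> inv x \<in> word_ball G S R"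
  using word_length_inv_le[of S x] by (fastforce simp: word_ball_def)

lemma word_ball_mono: "R \<le> R' \<Longrightarrow> word_ball G S R \<subseteq> word_ball G S R'"
  by (auto simp: word_ball_def)

text \<open>The pieces are the fibres of \<open>f\<close>, and \<open>c\<close> colours the fibres.
  Points at distance at most \<open>R\<close> differ by right multiplication with a ball element, so
  \<open>sep\<close> says that fibres of one colour are far apart. Left translations are isometries,
  so for a subset of \<open>x B\<close> it suffices to pull \<open>f\<close> back by
  \<open>inv x\<close>.\<close>

lemma translate_family_decomposes:
  assumes gen: "finite_symmetric_generating_set G S"
    and B: "B \<subseteq> carrier G" and B': "B' \<subseteq> carrier G"
    and colour: "\<And>x. x \<in> B \<Longrightarrow> c (f x) \<in> {1..n}"
    and sep: "\<And>x z. x \<in> B \<Longrightarrow> z \<in> word_ball G S R \<Longrightarrow> x \<otimes> z \<in> B \<Longrightarrow>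
                c (f x) = c (f (x \<otimes> z)) \<Longrightarrow> f x = f (x \<otimes> z)"
    and piece: "\<And>y. y \<in> B \<Longrightarrow>
                  \<exists>x\<in>carrier G. \<forall>z\<in>B. f z = f y \<longrightarrow> (\<exists>b\<in>B'. z = x \<otimes> b)"
  shows "family_decomposes_over (translate_family G S B) R n (translate_family G S B')"
  unfolding family_decomposes_over_def
proof
  let ?X = "word_metric G S"
  fix Y assume "Y \<in> translate_family G S B"
  then obtain A x where Y: "Y = submetric ?X A" and x: "x \<in> carrier G"
    and A: "A \<subseteq> (\<lambda>y. x \<otimes> y) ` B"
    by (auto simp: translate_family_def)
  have AG: "A \<subseteq> carrier G" using A x B by auto
  have inB: "inv x \<otimes> a \<in> B" if "a \<in> A" for a
    using that A x B by (auto simp: subset_iff simp flip: m_assoc)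
  \<comment> \<open>Indexing the fibres by points \<open>b\<close> of \<open>A\<close> makes all of
    them nonempty.\<close>
  define P where "P i = {{a \<in> A. f (inv x \<otimes> a) = f (inv x \<otimes> b)} |b. b \<in> A \<and> c (f (inv x \<otimes> b)) = i}" for i
  have spY: "mspace Y = A"
    using AG by (auto simp: Y mspace_word_metric[OF gen])
  show "decomposes_over Y R n (translate_family G S B')"
    unfolding decomposes_over_def
  proof (intro exI[of _ P] conjI ballI)
    fix i assume i: "i \<in> {1..n}"
    show "R_disjoint Y R (P i)"
      unfolding R_disjoint_def
    proof (intro conjI ballI impI)
      fix U assume "U \<in> P i"
      then show "U \<noteq> {}" "U \<subseteq> mspace Y" by (auto simp: P_def spY)
    next
      fix U V assume "U \<in> P i" "V \<in> P i" "U \<noteq> V"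
      then obtain u v where u: "u \<in> A" "c (f (inv x \<otimes> u)) = i" "U = {a \<in> A. f (inv x \<otimes> a) = f (inv x \<otimes> u)}"
        and v: "v \<in> A" "c (f (inv x \<otimes> v)) = i" "V = {a \<in> A. f (inv x \<otimes> a) = f (inv x \<otimes> v)}"
        by (auto simp: P_def)
      have neq: "f (inv x \<otimes> u) \<noteq> f (inv x \<otimes> v)" using u v \<open>U \<noteq> V\<close> by auto
      \<comment> \<open>A strict bound \<open>> R\<close> on distances need not survive the infimum.
        Word lengths are integers, so the bound can be raised to \<open>floor R + 1\<close>, which
        does survive and still exceeds \<open>R\<close>.\<close>
      have far: "real_of_int (\<lfloor>R\<rfloor> + 1) \<le> mdist Y a b" if ab: "a \<in> U" "b \<in> V" for a b
      proof -
        have abA: "a \<in> A" "b \<in> A" using ab u v by auto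
        then have G: "a \<in> carrier G" "b \<in> carrier G" using AG by auto
        have eq: "inv x \<otimes> a \<otimes> (inv a \<otimes> b) = inv x \<otimes> b"
          using G x by (metis inv_closed inv_solve_left m_assoc m_closed)
        have fab: "f (inv x \<otimes> a) = f (inv x \<otimes> u)" "f (inv x \<otimes> b) = f (inv x \<otimes> v)"
          using ab u v by auto
        have "inv a \<otimes> b \<notin> word_ball G S R"
        proof
          assume "inv a \<otimes> b \<in> word_ball G S R"
          from sep[OF inB[OF abA(1)] this] have "f (inv x \<otimes> a) = f (inv x \<otimes> b)"
            unfolding eq fab using inB[OF abA(2)] u(2) v(2) by simp
          then show False using neq unfolding fab by simp
        qed
        then have "R < real (word_length G S (inv a \<otimes> b))"
          using G by (auto simp: word_ball_def)
        then have "\<lfloor>R\<rfloor> + 1 \<le> int (word_length G S (inv a \<otimes> b))" by linarith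
        then show ?thesis
          using G by (simp add: Y mdist_word_metric[OF gen] word_dist_def)
      qed
      have "real_of_int (\<lfloor>R\<rfloor> + 1) \<le> set_mdist Y U V"
        unfolding set_mdist_def
      proof (rule cInf_greatest)
        show "{mdist Y a b |a b. a \<in> U \<and> b \<in> V} \<noteq> {}" using u v by blast
      qed (use far in auto)
      then show "R < set_mdist Y U V" by linarith
    qed
  next
    show "\<Union> (\<Union>i\<in>{1..n}. P i) = mspace Y"
    proof
      show "mspace Y \<subseteq> \<Union> (\<Union>i\<in>{1..n}. P i)"
      proof
        fix a assume "a \<in> mspace Y"
        then have a: "a \<in> A" by (simp add: spY)
        then show "a \<in> \<Union> (\<Union>i\<in>{1..n}. P i)"
          using colour[OF inB[OF a]] unfolding P_def by blast
      qed
    qed (auto simp: P_def spY)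
  next
    show "submetric Y ` (\<Union>i\<in>{1..n}. P i) \<subseteq> translate_family G S B'"
    proof (rule image_subsetI)
      fix U assume "U \<in> (\<Union>i\<in>{1..n}. P i)"
      then obtain u where u: "u \<in> A" "U = {a \<in> A. f (inv x \<otimes> a) = f (inv x \<otimes> u)}"
        by (auto simp: P_def)
      obtain p where p: "p \<in> carrier G" "\<forall>z\<in>B. f z = f (inv x \<otimes> u) \<longrightarrow> (\<exists>b\<in>B'. z = p \<otimes> b)"
        using piece[OF inB[OF u(1)]] by blast
      have "U \<subseteq> (\<lambda>z. x \<otimes> p \<otimes> z) ` B'"
      proof
        fix a assume a: "a \<in> U"
        then have "inv x \<otimes> a \<in> B" "f (inv x \<otimes> a) = f (inv x \<otimes> u)" using u inB by auto
        then obtain b where b: "b \<in> B'" "inv x \<otimes> a = p \<otimes> b" using p by auto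
        have "a \<in> carrier G" using a u AG by auto
        then have "a = x \<otimes> (p \<otimes> b)"
          using x by (simp flip: b(2)) (simp flip: m_assoc)
        moreover have "x \<otimes> (p \<otimes> b) = x \<otimes> p \<otimes> b"
          using x p b B' by (simp add: m_assoc subset_iff)
        ultimately show "a \<in> (\<lambda>z. x \<otimes> p \<otimes> z) ` B'" using b by auto
      qed
      moreover have "submetric Y U = submetric ?X U"
        using u by (simp add: Y Int_absorb1 subset_iff)
      ultimately show "submetric Y U \<in> translate_family G S B'"
        using x p by (auto simp: translate_family_def)
    qed
  qed
qed

text \<open>By left invariance the diameter of \<open>B\<close> bounds that of every subset of a
  translate of \<open>B\<close>.\<close>

lemma uniformly_bounded_translate_family:
  assumes gen: "finite_symmetric_generating_set G S" and B: "B \<subseteq> carrier G" "finite B"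
  shows "uniformly_bounded (translate_family G S B)"
proof -
  let ?X = "word_metric G S"
  define D where "D = Max (insert 0 ((\<lambda>(a, b). word_length G S (inv a \<otimes> b)) ` (B \<times> B)))"
  have "(SUP Y\<in>translate_family G S B. metric_diameter Y) \<le> ennreal (real D)"
  proof (rule SUP_least)
    fix Y assume "Y \<in> translate_family G S B"
    then obtain A x where Y: "Y = submetric ?X A" and x: "x \<in> carrier G"
      and A: "A \<subseteq> (\<lambda>y. x \<otimes> y) ` B"
      by (auto simp: translate_family_def)
    show "metric_diameter Y \<le> ennreal (real D)"
      unfolding metric_diameter_def
    proof (intro SUP_least)
      fix u v assume "u \<in> mspace Y" "v \<in> mspace Y"
      then have "u \<in> A" "v \<in> A" by (simp_all add: Y)
      then obtain a b where ab: "a \<in> B" "b \<in> B" "u = x \<otimes> a" "v = x \<otimes> b"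
        using A by blast
      then have G: "a \<in> carrier G" "b \<in> carrier G" using B by auto
      have "inv u \<otimes> v = inv a \<otimes> b"
        using G x ab by (simp add: inv_mult_group m_assoc) (simp flip: m_assoc)
      then have "mdist Y u v = real (word_length G S (inv a \<otimes> b))"
        using G x ab by (simp add: Y mdist_word_metric[OF gen] word_dist_def)
      moreover have "word_length G S (inv a \<otimes> b) \<le> D"
        unfolding D_def using B ab by (intro Max_ge) auto
      ultimately show "ennreal (mdist Y u v) \<le> ennreal (real D)"
        by (simp add: ennreal_leI)
    qed
  qed
  also have "\<dots> < \<infinity>" by simp
  finally show ?thesis by (simp add: uniformly_bounded_def)
qed

end

section \<open>Chains of decompositions\<close>

text \<open>The chain of decompositions may have length 0, so that chains can be built step by step.\<close>

definition decomposition_chain :: "(real \<Rightarrow> nat) \<Rightarrow> (nat \<Rightarrow> real) \<Rightarrow> 'a metric set \<Rightarrow> bool" where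
  "decomposition_chain s R \<W> \<longleftrightarrow>
     (\<exists>n. \<exists>\<V> :: nat \<Rightarrow> 'a metric set. \<V> 0 = \<W> \<and>
        (\<forall>i<n. family_decomposes_over (\<V> i) (R i) (s (R i)) (\<V> (Suc i))) \<and>
        uniformly_bounded (\<V> n))"

lemma decomposition_chain_0: "uniformly_bounded \<W> \<Longrightarrow> decomposition_chain s R \<W>"
  unfolding decomposition_chain_def by (intro exI[of _ 0] exI[of _ "\<lambda>_. \<W>"]) simp

lemma decomposition_chain_step:
  assumes step: "family_decomposes_over \<W> (R 0) (s (R 0)) \<W>'"
    and chain: "decomposition_chain s (\<lambda>i. R (Suc i)) \<W>'"
  shows "decomposition_chain s R \<W>"
proof -
  obtain n and \<V> :: "nat \<Rightarrow> 'a metric set" where V: "\<V> 0 = \<W>'"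
    "\<forall>i<n. family_decomposes_over (\<V> i) (R (Suc i)) (s (R (Suc i))) (\<V> (Suc i))"
    "uniformly_bounded (\<V> n)"
    using chain unfolding decomposition_chain_def by blast
  show ?thesis
    unfolding decomposition_chain_def
  proof (intro exI conjI allI impI)
    show "case_nat \<W> \<V> 0 = \<W>" by simp
    show "uniformly_bounded (case_nat \<W> \<V> (Suc n))" using V by simp
    fix i assume "i < Suc n"
    then show "family_decomposes_over (case_nat \<W> \<V> i) (R i) (s (R i)) (case_nat \<W> \<V> (Suc i))"
      using V step by (cases i) auto
  qed
qed

text \<open>The first decomposition, which leads from \<open>X\<close> to \<open>\<W>\<close>, is
  split off. It makes the total length positive even if the remaining chain is empty.\<close>

lemma decomposition_growth_functionI:
  assumes "mono_on {0<..} s"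
    and step: "\<And>R. 0 < R \<Longrightarrow> family_decomposes_over {X} R (s R) \<W>"
    and chain: "\<And>R. (\<And>i. 0 < R i) \<Longrightarrow> decomposition_chain s R \<W>"
  shows "decomposition_growth_function X s"
  unfolding decomposition_growth_function_def
proof (intro conjI allI impI)
  fix R :: "nat \<Rightarrow> real"
  assume R: "\<forall>i\<ge>1. 0 < R i \<and> R i \<le> R (Suc i)"
  \<comment> \<open>Radii are numbered from 1 and \<open>R 1\<close> is spent on the first step, so
    the remaining chain starts with \<open>R 2\<close>.\<close>
  have "decomposition_chain s (\<lambda>i. R (Suc (Suc i))) \<W>"
    by (rule chain) (use R in auto)
  then obtain n and \<V> :: "nat \<Rightarrow> 'a metric set" where V: "\<V> 0 = \<W>"
    "\<forall>i<n. family_decomposes_over (\<V> i) (R (Suc (Suc i))) (s (R (Suc (Suc i)))) (\<V> (Suc i))"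
    "uniformly_bounded (\<V> n)"
    unfolding decomposition_chain_def by blast
  have *: "family_decomposes_over (case_nat {X} \<V> (i - 1)) (R i) (s (R i)) (case_nat {X} \<V> i)"
    if i: "i \<in> {1..Suc n}" for i
  proof -
    obtain j where j: "i = Suc j" using i by (cases i) auto
    show ?thesis
    proof (cases j)
      case 0
      then show ?thesis using step[of "R 1"] R V by (simp add: j)
    next
      case (Suc k)
      then show ?thesis using V i by (simp add: j)
    qed
  qed
  show "\<exists>n\<ge>1. \<exists>\<V>. \<V> 0 = {X} \<and>
       (\<forall>i\<in>{1..n}. family_decomposes_over (\<V> (i - 1)) (R i) (s (R i)) (\<V> i)) \<and> uniformly_bounded (\<V> n)"
    using * V by (intro exI[of _ "Suc n"] conjI exI[of _ "case_nat {X} \<V>"] ballI) auto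
qed fact

section \<open>Greedy colouring\<close>

text \<open>Vertices are coloured in the order of an enumeration, each with the least colour not used by
  its earlier neighbours.\<close>

lemma greedy_colouring:
  assumes V: "countable V"
    and sym: "\<And>x y. E x y \<Longrightarrow> E y x"
    and deg: "\<And>x. x \<in> V \<Longrightarrow> finite {y \<in> V. E x y} \<and> card {y \<in> V. E x y} \<le> k"
  obtains c :: "'a \<Rightarrow> nat"
  where "\<And>x. x \<in> V \<Longrightarrow> c x \<le> k"
    and "\<And>x y. x \<in> V \<Longrightarrow> y \<in> V \<Longrightarrow> E x y \<Longrightarrow> x \<noteq> y \<Longrightarrow> c x \<noteq> c y"
proof -
  define e where "e = to_nat_on V"
  define r where "r = inv_image less_than e"
  have wf: "wf r" unfolding r_def by (rule wf_inv_image[OF wf_less_than])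
  \<comment> \<open>Recursion along the enumeration \<open>e\<close>. Only values at vertices with
    smaller index are consulted, so the cut-off in \<open>wfrec\<close> changes nothing.\<close>
  define c :: "'a \<Rightarrow> nat" where
    "c = wfrec r (\<lambda>g x. LEAST n. n \<notin> g ` {y \<in> V. E x y \<and> e y < e x})"
  define N where "N x = c ` {y \<in> V. E x y \<and> e y < e x}" for x
  have c: "c x = (LEAST n. n \<notin> N x)" for x
  proof -
    have "cut c r x ` {y \<in> V. E x y \<and> e y < e x} = N x"
      unfolding N_def by (intro image_cong) (auto simp: cut_def r_def)
    then show ?thesis
      using def_wfrec[OF eq_reflection[OF c_def] wf, of x] by simp
  qed
  have N: "finite (N x)" "card (N x) \<le> k" if x: "x \<in> V" for x
  proof -
    have sub: "{y \<in> V. E x y \<and> e y < e x} \<subseteq> {y \<in> V. E x y}" by blast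
    note fin = finite_subset[OF sub conjunct1[OF deg[OF x]]]
    show "finite (N x)" unfolding N_def using fin by (rule finite_imageI)
    have "card (N x) \<le> card {y \<in> V. E x y \<and> e y < e x}"
      unfolding N_def using fin by (rule card_image_le)
    also have "\<dots> \<le> card {y \<in> V. E x y}"
      using sub conjunct1[OF deg[OF x]] by (intro card_mono)
    also have "\<dots> \<le> k" using deg[OF x] by blast
    finally show "card (N x) \<le> k" .
  qed
  have less: "c x \<noteq> c y" if "x \<in> V" "y \<in> V" "E x y" "e y < e x" for x y
  proof -
    have "\<exists>n. n \<notin> N x"
      using N(1)[OF that(1)] by (rule ex_new_if_finite[OF infinite_UNIV_nat])
    then have "c x \<notin> N x" unfolding c[of x] by (rule LeastI_ex)
    moreover have "c y \<in> N x" unfolding N_def using that by blast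
    ultimately show ?thesis by metis
  qed
  show thesis
  proof
    fix x assume x: "x \<in> V"
    \<comment> \<open>Pigeonhole: \<open>k + 1\<close> colours are available and at most
      \<open>k\<close> are forbidden.\<close>
    have "\<not> {..k} \<subseteq> N x"
      using card_mono[OF N(1)[OF x], of "{..k}"] N(2)[OF x] by auto
    then obtain n where "n \<le> k" "n \<notin> N x" by auto
    then show "c x \<le> k" unfolding c[of x] by (meson Least_le order_trans)
  next
    fix x y assume xy: "x \<in> V" "y \<in> V" "E x y" "x \<noteq> y"
    then have "e x \<noteq> e y" using V by (simp add: e_def)
    then consider "e x < e y" | "e y < e x" by linarith
    then show "c x \<noteq> c y"
    proof cases
      case 1
      then show ?thesis using less[OF xy(2,1) sym[OF xy(3)]] by simp
    next
      case 2
      then show ?thesis using less[OF xy(1-3)] by simp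
    qed
  qed
qed

section \<open>Subexponential growth of Grigorchuk's group\<close>

datatype grig_letter = GA | GB | GC | GD

lemma UNIV_grig_letter: "UNIV = {GA, GB, GC, GD}"
  by (auto intro: grig_letter.exhaust)

fun grig_gen :: "grig_letter \<Rightarrow> bool list \<Rightarrow> bool list" where
  "grig_gen GA = grig_a"
| "grig_gen GB = grig_b"
| "grig_gen GC = grig_c"
| "grig_gen GD = grig_d"

definition grig_eval :: "grig_letter list \<Rightarrow> bool list \<Rightarrow> bool list" where
  "grig_eval w = foldr (\<lambda>x f. grig_gen x \<circ> f) w id"

lemma grig_eval_simps [simp]:
  "grig_eval [] = id" "grig_eval (x # w) = grig_gen x \<circ> grig_eval w"
  by (simp_all add: grig_eval_def)

lemma grig_eval_append: "grig_eval (u @ v) = grig_eval u \<circ> grig_eval v"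
  by (induction u) auto

lemma grig_gen_involution: "grig_gen x \<circ> grig_gen x = id"
  by (cases x) (auto simp: fun_eq_iff grig_involutions)

text \<open>Together with the identity, \<open>b\<close>, \<open>c\<close>, \<open>d\<close> form a
  Klein four-group. On words starting with 1 the recursion turns each of the three relations into
  the next one cyclically; on words starting with 0 only \<open>a a = 1\<close> enters.\<close>

lemma grig_products:
  "grig_b (grig_c w) = grig_d w" "grig_c (grig_d w) = grig_b w" "grig_d (grig_b w) = grig_c w"
  by (induction w and w and w rule: grig_b_grig_c_grig_d.induct) (auto simp: grig_involutions)

lemma grig_products':
  "grig_c (grig_b w) = grig_d w" "grig_d (grig_c w) = grig_b w" "grig_b (grig_d w) = grig_c w"
  by (metis grig_products grig_involutions)+

text \<open>The generators are involutions, so words without inverses already exhaust the generated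
  subgroup.\<close>

lemma carrier_Grigorchuk_group: "carrier Grigorchuk_group = range grig_eval"
proof -
  interpret T: group tree_Aut by (rule group_tree_Aut)
  let ?S = "{grig_a, grig_b, grig_c, grig_d}"
  have Bij: "f \<in> carrier tree_Aut \<Longrightarrow> bij f" for f
    by (auto simp: tree_Aut_def tree_automorphisms_def Bij_def)
  have mult: "f \<otimes>\<^bsub>tree_Aut\<^esub> g = f \<circ> g"
    if "f \<in> carrier tree_Aut" "g \<in> carrier tree_Aut" for f g
    using that[THEN Bij] by (simp add: tree_Aut_def BijGroup_def Bij_def compose_def fun_eq_iff)
  have one_Aut: "\<one>\<^bsub>tree_Aut\<^esub> = id"
    by (simp add: tree_Aut_def BijGroup_def fun_eq_iff)
  have genS: "grig_gen x \<in> ?S" for x by (cases x) auto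
  have ex_gen: "\<exists>x. h = grig_gen x" if "h \<in> ?S" for h
    using that grig_gen.simps by (metis empty_iff insert_iff)
  have genC: "grig_gen x \<in> carrier tree_Aut" for x using genS[of x] grig_in_tree_Aut by blast
  have "grig_eval w \<in> generate tree_Aut ?S \<and> grig_eval w \<in> carrier tree_Aut" for w
  proof (induction w)
    case Nil
    show ?case using generate.one[of tree_Aut ?S] T.one_closed
      unfolding one_Aut grig_eval_simps by blast
  next
    case (Cons x w)
    have "grig_gen x \<otimes>\<^bsub>tree_Aut\<^esub> grig_eval w \<in> generate tree_Aut ?S"
      using Cons generate.incl[OF genS] by (intro generate.eng) blast+
    moreover have "grig_gen x \<otimes>\<^bsub>tree_Aut\<^esub> grig_eval w \<in> carrier tree_Aut"
      using Cons genC by auto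
    ultimately show ?case unfolding grig_eval_simps using Cons genC by (metis mult)
  qed
  moreover have "f \<in> range grig_eval \<and> f \<in> carrier tree_Aut" if "f \<in> generate tree_Aut ?S" for f
    using that
  proof induction
    case one
    show ?case by (metis T.one_closed one_Aut grig_eval_simps(1) rangeI)
  next
    case (incl h)
    then obtain x where "h = grig_gen x" using ex_gen by blast
    then have "h = grig_eval [x]" by simp
    then show ?case using genC \<open>h = grig_gen x\<close> by (metis rangeI)
  next
    case (inv h)
    then obtain x where h: "h = grig_gen x" using ex_gen by blast
    have "inv\<^bsub>tree_Aut\<^esub> h = h"
      by (rule T.inv_equality) (use genC in \<open>auto simp: h mult one_Aut grig_gen_involution\<close>)
    moreover have "h = grig_eval [x]" by (simp add: h)
    ultimately show ?case using genC h by (metis rangeI)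
  next
    case (eng h1 h2)
    then show ?case using mult T.m_closed by (metis grig_eval_append imageE rangeI)
  qed
  ultimately show ?thesis
    unfolding Grigorchuk_group_def T.carrier_subgroup_generated_subset
    using grig_in_tree_Aut by (auto simp: carrier_subgroup_generated Int_absorb1)
qed

lemma mult_Grigorchuk_group:
  assumes "f \<in> carrier Grigorchuk_group" "g \<in> carrier Grigorchuk_group"
  shows "f \<otimes>\<^bsub>Grigorchuk_group\<^esub> g = f \<circ> g"
proof -
  interpret T: group tree_Aut by (rule group_tree_Aut)
  have "f \<in> carrier tree_Aut" "g \<in> carrier tree_Aut"
    using assms T.carrier_subgroup_generated_subset[of "{grig_a, grig_b, grig_c, grig_d}"]
    by (auto simp: Grigorchuk_group_def)
  then show ?thesis
    by (simp add: Grigorchuk_group_def tree_Aut_def tree_automorphisms_def BijGroup_def Bij_def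
        compose_def fun_eq_iff)
qed

lemma one_Grigorchuk_group: "\<one>\<^bsub>Grigorchuk_group\<^esub> = id"
  by (simp add: Grigorchuk_group_def tree_Aut_def BijGroup_def fun_eq_iff)

text \<open>The weights approximate Bartholdi's optimal ones by small integers. What matters is that
  passing from a pair \<open>a x\<close> with \<open>x \<in> {b, c, d}\<close> to the two sections of \<open>x\<close> shrinks the total
  weight by a factor of at most 5/6, while no weight of \<open>b\<close>, \<open>c\<close>, \<open>d\<close> exceeds the sum of the other two.\<close>

fun letter_weight :: "grig_letter \<Rightarrow> nat" where
  "letter_weight GA = 3"
| "letter_weight GB = 3"
| "letter_weight GC = 2"
| "letter_weight GD = 1"

definition word_weight :: "grig_letter list \<Rightarrow> nat" where
  "word_weight w = sum_list (map letter_weight w)"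

lemma word_weight_simps [simp]:
  "word_weight [] = 0" "word_weight (x # w) = letter_weight x + word_weight w"
  "word_weight (u @ v) = word_weight u + word_weight v"
  by (simp_all add: word_weight_def)

lemma length_le_word_weight: "length w \<le> word_weight w"
proof (induction w)
  case (Cons x w)
  then show ?case by (cases x) auto
qed simp

section \<open>Reduction to alternating words\<close>

fun third_letter :: "grig_letter \<Rightarrow> grig_letter \<Rightarrow> grig_letter" where
  "third_letter GB GC = GD"
| "third_letter GC GB = GD"
| "third_letter GB GD = GC"
| "third_letter GD GB = GC"
| "third_letter _ _ = GB"

fun reduce_Cons :: "grig_letter \<Rightarrow> grig_letter list \<Rightarrow> grig_letter list" where
  "reduce_Cons x [] = [x]"
| "reduce_Cons x (y # w) =
     (if x = y then w else if x \<noteq> GA \<and> y \<noteq> GA then third_letter x y # w else x # y # w)"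

fun alternating :: "grig_letter list \<Rightarrow> bool" where
  "alternating (x # y # w) \<longleftrightarrow> (x = GA) \<noteq> (y = GA) \<and> alternating (y # w)"
| "alternating _ \<longleftrightarrow> True"

text \<open>In the Klein four-group two distinct nontrivial elements multiply to the third. Under
  these assumptions the catch-all clause of \<open>third_letter\<close> is reached only by the pairs
  of \<open>GC\<close> and \<open>GD\<close>.\<close>

lemma third_letter:
  assumes "x \<noteq> GA" "y \<noteq> GA" "x \<noteq> y"
  shows "third_letter x y \<noteq> GA" "grig_gen (third_letter x y) = grig_gen x \<circ> grig_gen y"
    "letter_weight (third_letter x y) \<le> letter_weight x + letter_weight y"
  using assms
  by (cases x; cases y; simp add: fun_eq_iff grig_products grig_products')+

text \<open>A single rewriting suffices: behind a letter other than \<open>GA\<close> an alternating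
  word ends or continues with \<open>GA\<close>, so neither cancelling nor merging creates a new
  conflict.\<close>

lemma alternating_reduce_Cons: "alternating w \<Longrightarrow> alternating (reduce_Cons x w)"
proof (cases w)
  case (Cons y v)
  assume "alternating w"
  then show ?thesis using third_letter(1)[of x y] by (cases v) (auto simp: Cons)
qed simp

lemma word_weight_reduce_Cons: "word_weight (reduce_Cons x w) \<le> letter_weight x + word_weight w"
proof (cases w)
  case (Cons y v)
  then show ?thesis using third_letter(3)[of x y] by auto
qed simp

lemma grig_eval_reduce_Cons: "grig_eval (reduce_Cons x w) = grig_gen x \<circ> grig_eval w"
proof (cases w)
  case (Cons y v)
  show ?thesis
  proof (cases "x = y")
    case True
    have "grig_gen x \<circ> (grig_gen x \<circ> grig_eval v) = grig_eval v"
      by (simp add: grig_gen_involution flip: comp_assoc)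
    then show ?thesis using Cons True by simp
  qed (use Cons third_letter(2)[of x y] in \<open>auto simp: comp_assoc\<close>)
qed simp

text \<open>Letters are prepended one at a time. The contraction estimate holds for alternating
  words, and this lemma makes it available for words of least weight.\<close>

lemma ex_alternating:
  "\<exists>v. alternating v \<and> word_weight v \<le> word_weight w \<and> grig_eval v = grig_eval w"
proof (induction w)
  case Nil
  show ?case by (intro exI[of _ "[]"]) simp
next
  case (Cons x w)
  then obtain v where "alternating v" "word_weight v \<le> word_weight w" "grig_eval v = grig_eval w"
    by blast
  then show ?case
    using alternating_reduce_Cons[of v x] word_weight_reduce_Cons[of x v]
    by (intro exI[of _ "reduce_Cons x v"]) (auto simp: grig_eval_reduce_Cons)
qed

section \<open>Sections at the first level\<close>

fun letter_section :: "bool \<Rightarrow> grig_letter \<Rightarrow> grig_letter list" where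
  "letter_section _ GA = []"
| "letter_section False GB = [GA]"
| "letter_section True GB = [GC]"
| "letter_section False GC = [GA]"
| "letter_section True GC = [GD]"
| "letter_section False GD = []"
| "letter_section True GD = [GB]"

fun word_perm :: "grig_letter list \<Rightarrow> bool \<Rightarrow> bool" where
  "word_perm [] v = v"
| "word_perm (x # w) v = ((x = GA) \<noteq> word_perm w v)"

text \<open>The chain rule for sections: the section of \<open>x\<close> is taken at the letter to
  which the tail \<open>w\<close> has moved \<open>v\<close>.\<close>

fun word_section :: "bool \<Rightarrow> grig_letter list \<Rightarrow> grig_letter list" where
  "word_section v [] = []"
| "word_section v (x # w) = letter_section (word_perm w v) x @ word_section v w"

lemma word_perm_True: "word_perm w True \<longleftrightarrow> \<not> word_perm w False"
  by (induction w) auto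

lemma grig_gen_Cons: "grig_gen x (v # u) = ((x = GA) \<noteq> v) # grig_eval (letter_section v x) u"
  by (cases x; cases v) auto

lemma grig_eval_Cons: "grig_eval w (v # u) = word_perm w v # grig_eval (word_section v w) u"
  by (induction w) (auto simp: grig_gen_Cons grig_eval_append)

lemma grig_eval_Nil: "grig_eval w [] = []"
proof (induction w)
  case (Cons x w)
  then show ?case by (cases x) auto
qed simp

text \<open>Each of \<open>b\<close>, \<open>c\<close>, \<open>d\<close> is paired with the
  \<open>a\<close> to its left: such a pair has weight 6, 5 or 4, and the two sections of its second
  letter weigh 5, 4 or 3 in total. A leading letter other than \<open>a\<close> lacks its partner,
  and \<open>15 = 5 * 3\<close> is the missing contribution of that \<open>a\<close>.\<close>

lemma word_section_weight:
  assumes "alternating w"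
  shows "6 * (word_weight (word_section False w) + word_weight (word_section True w))
           \<le> 5 * word_weight w + (if w = [] \<or> hd w = GA then 0 else 15)"
  using assms
proof (induction w)
  case (Cons x w)
  have alt: "alternating w" using Cons.prems by (cases w) auto
  have hd: "w = [] \<or> hd w = GA" if "x \<noteq> GA" using Cons.prems that by (cases w) auto
  \<comment> \<open>The tail permutes the two letters, so each section of \<open>x\<close> goes to
    exactly one of the two section words.\<close>
  have "word_weight (word_section False (x # w)) + word_weight (word_section True (x # w)) =
        word_weight (letter_section False x) + word_weight (letter_section True x) +
        (word_weight (word_section False w) + word_weight (word_section True w))"
    by (cases "word_perm w False") (simp_all add: word_perm_True)
  moreover have "6 * (word_weight (letter_section False x) + word_weight (letter_section True x))
      \<le> 5 * letter_weight x + 15" "x = GA \<Longrightarrow> word_weight (letter_section v x) = 0" for v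
    by (cases x; simp)+
  ultimately show ?case
    using Cons.IH[OF alt] hd by (cases "x = GA") (auto simp: algebra_simps split: if_splits)
qed simp

section \<open>The weighted norm and its contraction\<close>

definition grig_norm :: "(bool list \<Rightarrow> bool list) \<Rightarrow> nat" where
  "grig_norm g = (LEAST n. \<exists>w. word_weight w = n \<and> grig_eval w = g)"

lemma grig_norm_le: "grig_norm (grig_eval w) \<le> word_weight w"
  unfolding grig_norm_def by (rule Least_le) blast

text \<open>Making a word of least weight alternating does not raise its weight, hence keeps it
  minimal.\<close>

lemma grig_norm_attained:
  assumes "g \<in> range grig_eval"
  obtains w where "word_weight w = grig_norm g" "grig_eval w = g" "alternating w"
proof -
  have "\<exists>n w. word_weight w = n \<and> grig_eval w = g" using assms by blast
  from LeastI_ex[OF this] obtain w where w: "word_weight w = grig_norm g" "grig_eval w = g"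
    unfolding grig_norm_def by blast
  obtain v where "alternating v" "word_weight v \<le> word_weight w" "grig_eval v = g"
    using ex_alternating[of w] w by auto
  then show thesis using that grig_norm_le[of v] w by force
qed

lemma grig_norm_comp:
  assumes "g \<in> range grig_eval" "h \<in> range grig_eval"
  shows "grig_norm (g \<circ> h) \<le> grig_norm g + grig_norm h"
proof -
  obtain u where u: "word_weight u = grig_norm g" "grig_eval u = g"
    using grig_norm_attained[OF assms(1)] .
  obtain v where v: "word_weight v = grig_norm h" "grig_eval v = h"
    using grig_norm_attained[OF assms(2)] .
  show ?thesis using grig_norm_le[of "u @ v"] u v by (simp add: grig_eval_append)
qed

lemma grig_norm_id: "grig_norm id = 0"
  using grig_norm_le[of "[]"] by simp

text \<open>For a tree automorphism the head of \<open>g (v # u)\<close> depends only on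
  \<open>v\<close>; removing it leaves the action on the subtree below \<open>v\<close>.\<close>

definition grig_section :: "bool \<Rightarrow> (bool list \<Rightarrow> bool list) \<Rightarrow> bool list \<Rightarrow> bool list" where
  "grig_section v g = (\<lambda>u. tl (g (v # u)))"

lemma grig_section_eval: "grig_section v (grig_eval w) = grig_eval (word_section v w)"
  by (simp add: grig_section_def grig_eval_Cons fun_eq_iff)

text \<open>For an alternating word of least weight the section words represent the sections of
  \<open>g\<close>, so their weights bound the norms. The constant 15 covers both cases of the first
  letter.\<close>

lemma grig_norm_sections:
  assumes "g \<in> range grig_eval"
  shows "6 * (grig_norm (grig_section False g) + grig_norm (grig_section True g)) \<le> 5 * grig_norm g + 15"
proof -
  obtain w where w: "word_weight w = grig_norm g" "grig_eval w = g" "alternating w"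
    using grig_norm_attained[OF assms] .
  have "grig_norm (grig_section v g) \<le> word_weight (word_section v w)" for v
    using grig_norm_le[of "word_section v w"] w(2) by (auto simp flip: grig_section_eval)
  from this[of False] this[of True] show ?thesis
    using word_section_weight[OF w(3)] w(1) by (auto split: if_splits)
qed

text \<open>The image of \<open>[False]\<close> determines the permutation of the first level, and
  the two sections determine the rest.\<close>

lemma inj_on_grig_sections:
  "inj_on (\<lambda>g. (g [False], grig_section False g, grig_section True g)) (range grig_eval)"
proof (rule inj_onI, clarify)
  fix w w'
  assume eq: "grig_eval w [False] = grig_eval w' [False]"
    "grig_section False (grig_eval w) = grig_section False (grig_eval w')"
    "grig_section True (grig_eval w) = grig_section True (grig_eval w')"
  have "word_perm w v = word_perm w' v" for v
    using eq(1) by (cases v) (auto simp: grig_eval_Cons word_perm_True)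
  moreover have "grig_eval (word_section v w) = grig_eval (word_section v w')" for v
    using eq(2,3) by (cases v) (auto simp: grig_section_eval)
  ultimately have "grig_eval w u = grig_eval w' u" for u
    by (cases u) (auto simp: grig_eval_Nil grig_eval_Cons)
  then show "grig_eval w = grig_eval w'" by blast
qed

section \<open>Convergence of the growth series, stated through bounded partial sums\<close>

definition grig_zeta_bounded :: "real \<Rightarrow> bool" where
  "grig_zeta_bounded \<epsilon> \<longleftrightarrow>
     (\<exists>K. \<forall>F. finite F \<and> F \<subseteq> range grig_eval \<longrightarrow> (\<Sum>g\<in>F. exp (- \<epsilon> * grig_norm g)) \<le> K)"

text \<open>With four letters of weight \<open>1/8\<close>, each further letter contributes a factor
  \<open>4/8\<close>. The recursion \<open>s' = 1 + s / 2\<close> preserves the bound 2.\<close>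

lemma sum_words_le:
  "(\<Sum>w | length (w :: grig_letter list) \<le> n. (1 / 8) ^ length w) \<le> (2 :: real)"
proof (induction n)
  case 0
  have "{w :: grig_letter list. length w \<le> 0} = {[]}" by auto
  then show ?case by simp
next
  case (Suc n)
  let ?L = "{w :: grig_letter list. length w \<le> n}"
  have fin: "finite (UNIV :: grig_letter set)" by (simp add: UNIV_grig_letter)
  then have finL: "finite ?L" using finite_lists_length_le[OF fin, of n] by simp
  have eq: "{w :: grig_letter list. length w \<le> Suc n} = insert [] ((\<lambda>(x, w). x # w) ` (UNIV \<times> ?L))"
  proof (rule Set.set_eqI)
    fix w :: "grig_letter list"
    show "w \<in> {w. length w \<le> Suc n} \<longleftrightarrow> w \<in> insert [] ((\<lambda>(x, w). x # w) ` (UNIV \<times> ?L))"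
      by (cases w) auto
  qed
  have "(\<Sum>w | length (w :: grig_letter list) \<le> Suc n. (1 / 8) ^ length w :: real) =
        1 + (\<Sum>w\<in>(\<lambda>(x, w). x # w) ` (UNIV \<times> ?L). (1 / 8) ^ length w)"
    unfolding eq by (subst sum.insert) (use fin finL in auto)
  also have "(\<Sum>w\<in>(\<lambda>(x, w). x # w) ` (UNIV \<times> ?L). (1 / 8) ^ length w :: real) =
        (\<Sum>x\<in>(UNIV :: grig_letter set). \<Sum>w\<in>?L. (1 / 8) * (1 / 8) ^ length w)"
    unfolding sum.cartesian_product by (subst sum.reindex) (auto simp: inj_on_def intro!: sum.cong)
  also have "\<dots> = 1 / 2 * (\<Sum>w\<in>?L. (1 / 8) ^ length w)"
    by (simp add: UNIV_grig_letter flip: sum_divide_distrib)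
  finally show ?case using Suc by simp
qed

text \<open>A word is no longer than its weight, so \<open>8\<close> to the power minus the norm is
  at most \<open>8\<close> to the power minus the length of a chosen representative. The choice is
  injective, so the sum over words bounds the sum over group elements.\<close>

lemma grig_zeta_bounded_base: "grig_zeta_bounded (ln 8)"
  unfolding grig_zeta_bounded_def
proof (intro exI[of _ 2] allI impI, elim conjE)
  fix F assume F: "finite F" "F \<subseteq> range grig_eval"
  have "\<forall>g\<in>F. \<exists>w. word_weight w = grig_norm g \<and> grig_eval w = g"
  proof
    fix g assume "g \<in> F"
    then have "g \<in> range grig_eval" using F(2) by (rule rev_subsetD)
    from grig_norm_attained[OF this] show "\<exists>w. word_weight w = grig_norm g \<and> grig_eval w = g"
      by blast
  qed
  from bchoice[OF this] obtain W
    where W': "\<forall>g\<in>F. word_weight (W g) = grig_norm g \<and> grig_eval (W g) = g" ..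
  have W: "word_weight (W g) = grig_norm g" "grig_eval (W g) = g" if "g \<in> F" for g
    using W' that by simp_all
  have inj: "inj_on W F" by (rule inj_on_inverseI[of _ grig_eval]) (rule W(2))
  define n where "n = Max (insert 0 (length ` W ` F))"
  have fin: "finite (UNIV :: grig_letter set)" by (simp add: UNIV_grig_letter)
  have finL: "finite {w :: grig_letter list. length w \<le> n}"
    using finite_lists_length_le[OF fin, of n] by simp
  have "(\<Sum>g\<in>F. exp (- ln 8 * grig_norm g)) \<le> (\<Sum>g\<in>F. (1 / 8) ^ length (W g) :: real)"
  proof (rule sum_mono)
    fix g assume g: "g \<in> F"
    have "exp (- ln 8 * grig_norm g) = (1 / 8 :: real) ^ grig_norm g"
      by (simp add: exp_minus exp_of_nat2_mult power_one_over inverse_eq_divide)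
    also have "\<dots> \<le> (1 / 8) ^ length (W g)"
      using W(1)[OF g] length_le_word_weight[of "W g"] by (intro power_decreasing) auto
    finally show "exp (- ln 8 * grig_norm g) \<le> (1 / 8) ^ length (W g)" .
  qed
  also have "\<dots> = (\<Sum>w\<in>W ` F. (1 / 8) ^ length w)"
    using inj by (simp add: sum.reindex)
  also have "\<dots> \<le> (\<Sum>w | length (w :: grig_letter list) \<le> n. (1 / 8) ^ length w)"
    using F(1) finL by (intro sum_mono2) (auto simp: n_def)
  also have "\<dots> \<le> 2" by (rule sum_words_le)
  finally show "(\<Sum>g\<in>F. exp (- ln 8 * grig_norm g)) \<le> 2" .
qed

text \<open>By contraction the term of \<open>g\<close> at \<open>\<epsilon>\<close> is at most
  \<open>exp (3 * \<epsilon>)\<close> times the product of the terms of its two sections at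
  \<open>6/5 * \<epsilon>\<close>. Summing over all triples of first-level action and sections costs
  a factor 2 for the action and \<open>K\<close> for each section.\<close>

lemma grig_zeta_bounded_step:
  assumes "\<epsilon> > 0" and "grig_zeta_bounded (6 / 5 * \<epsilon>)"
  shows "grig_zeta_bounded \<epsilon>"
proof -
  obtain K where K: "\<And>F. finite F \<Longrightarrow> F \<subseteq> range grig_eval \<Longrightarrow>
      (\<Sum>g\<in>F. exp (- (6 / 5 * \<epsilon>) * grig_norm g)) \<le> K"
    using assms(2) unfolding grig_zeta_bounded_def by blast
  let ?z = "\<lambda>g. exp (- (6 / 5 * \<epsilon>) * grig_norm g)"
  have "(\<Sum>g\<in>F. exp (- \<epsilon> * grig_norm g)) \<le> exp (3 * \<epsilon>) * (2 * (K * K))"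
    if F: "finite F" "F \<subseteq> range grig_eval" for F
  proof -
    let ?F0 = "grig_section False ` F" and ?F1 = "grig_section True ` F"
    let ?\<psi> = "\<lambda>g. (g [False], grig_section False g, grig_section True g)"
    let ?D = "(\<lambda>g. g [False]) ` F"
    have sub: "?F0 \<subseteq> range grig_eval" "?F1 \<subseteq> range grig_eval"
      using F(2) by (auto simp: grig_section_eval)
    have "grig_eval w [False] \<in> {[False], [True]}" for w by (simp add: grig_eval_Cons grig_eval_Nil)
    then have "?D \<subseteq> {[False], [True]}" using F(2) by fastforce
    then have D: "card ?D \<le> 2"
      using card_mono[of "{[False], [True]}" ?D] by simp
    have "(\<Sum>g\<in>F. exp (- \<epsilon> * grig_norm g))
        \<le> (\<Sum>g\<in>F. exp (3 * \<epsilon>) * (?z (grig_section False g) * ?z (grig_section True g)))"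
    proof (rule sum_mono)
      fix g assume "g \<in> F"
      then have "6 * (grig_norm (grig_section False g) + grig_norm (grig_section True g))
          \<le> 5 * grig_norm g + 15"
        using F(2) by (intro grig_norm_sections) auto
      from of_nat_mono[OF this, where 'a = real]
      have "6 * (real (grig_norm (grig_section False g)) + real (grig_norm (grig_section True g)))
          \<le> 5 * real (grig_norm g) + 15" by simp
      \<comment> \<open>The factor \<open>\<epsilon> / 5\<close> turns the right-hand side into
        \<open>\<epsilon>\<close> times the norm plus \<open>3 * \<epsilon>\<close>.\<close>
      then have "\<epsilon> / 5 * (6 * (real (grig_norm (grig_section False g)) + real (grig_norm (grig_section True g))))
          \<le> \<epsilon> / 5 * (5 * real (grig_norm g) + 15)"
        using assms(1) by (intro mult_left_mono) auto
      then have "- \<epsilon> * grig_norm g \<le> 3 * \<epsilon> + (- (6 / 5 * \<epsilon>) * grig_norm (grig_section False g)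
          + - (6 / 5 * \<epsilon>) * grig_norm (grig_section True g))"
        by (simp add: algebra_simps)
      then show "exp (- \<epsilon> * grig_norm g)
          \<le> exp (3 * \<epsilon>) * (?z (grig_section False g) * ?z (grig_section True g))"
        by (simp only: exp_le_cancel_iff flip: exp_add)
    qed
    also have "\<dots> = exp (3 * \<epsilon>) * (\<Sum>g\<in>F. case ?\<psi> g of (_, g0, g1) \<Rightarrow> ?z g0 * ?z g1)"
      by (simp add: sum_distrib_left)
    also have "(\<Sum>g\<in>F. case ?\<psi> g of (_, g0, g1) \<Rightarrow> ?z g0 * ?z g1) =
        (\<Sum>p\<in>?\<psi> ` F. case p of (_, g0, g1) \<Rightarrow> ?z g0 * ?z g1)"
      using inj_on_subset[OF inj_on_grig_sections F(2)] by (simp add: sum.reindex)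
    \<comment> \<open>The terms are nonnegative, so the sum may be enlarged from the triples that
      occur to a full product, where it factorises.\<close>
    also have "\<dots> \<le> (\<Sum>p\<in>?D \<times> ?F0 \<times> ?F1. case p of (_, g0, g1) \<Rightarrow> ?z g0 * ?z g1)"
      using F(1) by (intro sum_mono2) auto
    also have "\<dots> = (\<Sum>_\<in>?D. \<Sum>g0\<in>?F0. \<Sum>g1\<in>?F1. ?z g0 * ?z g1)"
      by (simp only: sum.cartesian_product)
    also have "\<dots> = real (card ?D) * (sum ?z ?F0 * sum ?z ?F1)"
      by (simp add: sum_product)
    also have "\<dots> \<le> 2 * (K * K)"
    proof (rule mult_mono)
      have K0: "sum ?z ?F0 \<le> K" "sum ?z ?F1 \<le> K" using K F(1) sub by simp_all
      have nonneg: "0 \<le> sum ?z ?F0" "0 \<le> sum ?z ?F1" by (intro sum_nonneg exp_ge_zero)+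
      show "sum ?z ?F0 * sum ?z ?F1 \<le> K * K"
        using K0 nonneg by (intro mult_mono) linarith+
      show "0 \<le> sum ?z ?F0 * sum ?z ?F1" using nonneg by (rule mult_nonneg_nonneg)
    qed (use D in simp_all)
    finally show ?thesis by simp
  qed
  then show ?thesis unfolding grig_zeta_bounded_def by blast
qed

lemma grig_zeta_bounded_mono:
  assumes "\<epsilon> \<le> \<epsilon>'" and "grig_zeta_bounded \<epsilon>"
  shows "grig_zeta_bounded \<epsilon>'"
proof -
  have "(\<Sum>g\<in>F. exp (- \<epsilon>' * grig_norm g)) \<le> (\<Sum>g\<in>F. exp (- \<epsilon> * grig_norm g))" for F
    using assms(1) by (intro sum_mono) (simp add: mult_right_mono)
  then show ?thesis using assms(2) unfolding grig_zeta_bounded_def by (meson order_trans)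
qed

text \<open>Each step lowers the exponent by the factor \<open>5/6\<close>, starting from
  \<open>ln 8\<close>. Some iterate lies below \<open>\<epsilon>\<close>, and monotonicity does the
  rest.\<close>

lemma grig_zeta_bounded:
  assumes "\<epsilon> > 0"
  shows "grig_zeta_bounded \<epsilon>"
proof -
  have *: "grig_zeta_bounded ((5 / 6) ^ k * ln 8)" for k
  proof (induction k)
    case (Suc k)
    then have "grig_zeta_bounded (6 / 5 * ((5 / 6) ^ Suc k * ln 8))" by (simp add: mult.commute)
    then show ?case by (rule grig_zeta_bounded_step[rotated]) simp
  qed (simp add: grig_zeta_bounded_base)
  obtain k where "(5 / 6) ^ k < \<epsilon> / ln (8 :: real)"
    using real_arch_pow_inv[of "\<epsilon> / ln 8" "5 / 6"] assms by auto
  then have "(5 / 6) ^ k * ln 8 \<le> \<epsilon>" by (simp add: pos_less_divide_eq)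
  then show ?thesis using * grig_zeta_bounded_mono by blast
qed

text \<open>Every element of norm at most \<open>n\<close> contributes at least
  \<open>exp (- \<epsilon> * n)\<close> to a bounded sum.\<close>

lemma grig_ball_card:
  assumes "\<epsilon> > 0"
  obtains K where "K > 0"
    and "\<And>F n. finite F \<Longrightarrow> F \<subseteq> carrier Grigorchuk_group \<Longrightarrow>
           (\<And>g. g \<in> F \<Longrightarrow> real (grig_norm g) \<le> n) \<Longrightarrow> real (card F) \<le> K * exp (\<epsilon> * n)"
proof -
  obtain K where K: "\<And>F. finite F \<Longrightarrow> F \<subseteq> range grig_eval \<Longrightarrow>
      (\<Sum>g\<in>F. exp (- \<epsilon> * grig_norm g)) \<le> K"
    using grig_zeta_bounded[OF assms] unfolding grig_zeta_bounded_def by blast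
  show thesis
  proof
    show "max K 1 > 0" by simp
    fix F and n :: real
    assume F: "finite F" "F \<subseteq> carrier Grigorchuk_group"
      and n: "\<And>g. g \<in> F \<Longrightarrow> real (grig_norm g) \<le> n"
    have "real (card F) * exp (- \<epsilon> * n) = (\<Sum>g\<in>F. exp (- \<epsilon> * n))" by simp
    also have "\<dots> \<le> (\<Sum>g\<in>F. exp (- \<epsilon> * grig_norm g))"
      using n assms by (intro sum_mono) simp
    also have "\<dots> \<le> max K 1"
      using K[of F] F by (simp add: carrier_Grigorchuk_group le_max_iff_disj)
    finally show "real (card F) \<le> max K 1 * exp (\<epsilon> * n)"
      by (simp add: exp_minus field_simps)
  qed
qed

section \<open>Free groups\<close>

text \<open>In the product a suffix of \<open>u\<close> cancels against a prefix of \<open>w\<close>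
  of the same length \<open>j\<close>. This controls both the length of the product and the prefix
  it shares with \<open>u\<close>.\<close>

lemma foldr_cancel_Cons_form:
  "reduced_word u \<Longrightarrow>
     \<exists>j\<le>length u. j \<le> length w \<and> foldr cancel_Cons u w = take (length u - j) u @ drop j w"
proof (induction u)
  case (Cons l u)
  then obtain j where j: "j \<le> length u" "j \<le> length w"
    "foldr cancel_Cons u w = take (length u - j) u @ drop j w"
    using reduced_word_tl by blast
  show ?case
  proof (cases "j = length u")
    \<comment> \<open>A letter of \<open>u\<close> directly behind \<open>l\<close> has survived,
      and reducedness of \<open>l # u\<close> forbids cancellation with it.\<close>
    case False
    then obtain m v where u: "u = m # v" using j(1) by (cases u) auto
    obtain i where i: "length u - j = Suc i" using False j(1) by (metis Suc_diff_Suc le_neq_implies_less)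
    have "foldr cancel_Cons (l # u) w = l # take (length u - j) u @ drop j w"
      using Cons.prems j(3) by (simp add: i) (simp add: u)
    then show ?thesis using j by (intro exI[of _ j]) (simp add: Suc_diff_le)
  next
    \<comment> \<open>All of \<open>u\<close> is cancelled, so \<open>l\<close> meets what is left
      of \<open>w\<close> and may cancel one more letter.\<close>
    case True
    show ?thesis
    proof (cases "drop j w")
      case Nil
      then show ?thesis using j True by (intro exI[of _ j]) simp
    next
      case (Cons m v)
      then have "j < length w" "v = drop (Suc j) w" by (auto simp: drop_Suc tl_drop dest: arg_cong[of _ _ tl] intro: leI ccontr)
      then show ?thesis using j True Cons
        by (cases "m = letter_inv l") (auto intro: exI[of _ j] exI[of _ "Suc j"])
    qed
  qed
qed simp

lemma foldr_cancel_Cons_append: "reduced_word (u @ v) \<Longrightarrow> foldr cancel_Cons u v = u @ v"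
proof (induction u)
  case (Cons l u)
  then show ?case using reduced_word_tl[of l "u @ v"] cancel_Cons_reduced[of l "u @ v"] by simp
qed simp

lemma reduced_word_append: "reduced_word (u @ v) \<Longrightarrow> reduced_word u \<and> reduced_word v"
proof (induction u)
  case (Cons l u)
  then show ?case using reduced_word_tl[of l "u @ v"] by (cases u) auto
qed simp

text \<open>The Cayley tree is cut into annuli of width \<open>r\<close>, and each annulus is split according to the
  prefix ending one annulus earlier (\<open>0 - 1 = 0\<close> covers the innermost one). The classes are coloured
  by the parity of the annulus.\<close>

lemma free_group_colouring:
  fixes X :: "'x set"
  defines "F \<equiv> free_group X"
  assumes X: "finite X" and T: "finite T"
  obtains c :: "nat \<times> ('x \<times> bool) list \<Rightarrow> nat" and key and U
  where "\<And>k. c k \<in> {1..2}" "finite U" "U \<subseteq> carrier F"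
    and "\<And>h t. h \<in> carrier F \<Longrightarrow> t \<in> T \<Longrightarrow> c (key h) = c (key (h \<otimes>\<^bsub>F\<^esub> t)) \<Longrightarrow>
           key h = key (h \<otimes>\<^bsub>F\<^esub> t)"
    and "\<And>h. h \<in> carrier F \<Longrightarrow>
           \<exists>p\<in>carrier F. \<forall>h'\<in>carrier F. key h' = key h \<longrightarrow> (\<exists>u\<in>U. h' = p \<otimes>\<^bsub>F\<^esub> u)"
proof -
  \<comment> \<open>As \<open>r\<close> exceeds all lengths in \<open>T\<close>, multiplication by
    an element of \<open>T\<close> cancels fewer than \<open>r\<close> letters and moves by at most
    one annulus.\<close>
  define r where "r = Suc (Max (insert 0 (length ` T)))"
  have r: "length t < r" if "t \<in> T" for t
    using T that by (auto simp: r_def less_Suc_eq_le)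
  have r0: "r > 0" by (simp add: r_def)
  define key where "key h = (length h div r, take ((length h div r - 1) * r) h)" for h :: "('x \<times> bool) list"
  define c where "c k = Suc (fst k mod 2)" for k :: "nat \<times> ('x \<times> bool) list"
  \<comment> \<open>A word in annulus \<open>i\<close> has length below \<open>(i + 1) * r\<close>,
    so fewer than \<open>2 * r\<close> letters follow the prefix of length
    \<open>(i - 1) * r\<close>.\<close>
  define U where "U = {u \<in> carrier F. length u \<le> 2 * r}"
  show thesis
  proof
    show "c k \<in> {1..2}" for k
      by (auto simp: c_def)
    show "finite U"
    proof (rule finite_subset)
      show "U \<subseteq> {u. set u \<subseteq> X \<times> UNIV \<and> length u \<le> 2 * r}"
        by (auto simp: U_def F_def free_group_def)
      show "finite {u. set u \<subseteq> X \<times> (UNIV :: bool set) \<and> length u \<le> 2 * r}"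
        using X by (intro finite_lists_length_le) simp
    qed
    show "U \<subseteq> carrier F" by (auto simp: U_def)
  next
    fix h t assume h: "h \<in> carrier F" and t: "t \<in> T" and eq: "c (key h) = c (key (h \<otimes>\<^bsub>F\<^esub> t))"
    let ?h' = "h \<otimes>\<^bsub>F\<^esub> t"
    have "reduced_word h" using h by (simp add: F_def free_group_def)
    then obtain j where j: "j \<le> length h" "j \<le> length t" "?h' = take (length h - j) h @ drop j t"
      using foldr_cancel_Cons_form[of h t] by (auto simp: F_def free_group_def)
    have len: "length ?h' < length h + r" "length h < length ?h' + r"
      using j r[OF t] by auto
    have par: "(length h div r) mod 2 = (length ?h' div r) mod 2"
      using eq by (simp add: c_def key_def)
    from div_le_mono[OF less_imp_le[OF len(1)], of r] div_le_mono[OF less_imp_le[OF len(2)], of r]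
    have "length ?h' div r \<le> Suc (length h div r)" "length h div r \<le> Suc (length ?h' div r)"
      using r0 by simp_all
    \<comment> \<open>Annuli that are equal or adjacent and have the same parity are equal.\<close>
    moreover have "a = b" if "a \<le> Suc b" "b \<le> Suc a" "b mod 2 = a mod 2" for a b :: nat
      using that by presburger
    ultimately have div: "length ?h' div r = length h div r" using par by blast
    \<comment> \<open>In annulus \<open>i\<close> the last \<open>r\<close> letters lie behind the
      prefix of length \<open>(i - 1) * r\<close>, and fewer than \<open>r\<close> letters are
      cancelled.\<close>
    have "take ((length h div r - 1) * r) ?h' = take ((length h div r - 1) * r) h"
    proof (cases "length h div r")
      case (Suc k)
      have "Suc k * r \<le> length h" using Suc div_times_less_eq_dividend[of "length h" r] by simp
      then have "k * r \<le> length h - j" using j r[OF t] by simp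
      moreover have "length (take (length h - j) h) = length h - j" by simp
      ultimately show ?thesis using Suc by (simp only: j(3) take_append take_take) (simp add: min_def)
    qed simp
    then show "key h = key ?h'" by (simp add: key_def div)
  next
    fix h assume h: "h \<in> carrier F"
    let ?i = "(length h div r - 1) * r"
    have "h \<in> lists (X \<times> UNIV)" "reduced_word (take ?i h @ drop ?i h)"
      using h by (auto simp: F_def free_group_def)
    then have "take ?i h \<in> carrier F"
      using reduced_word_append[of "take ?i h" "drop ?i h"]
      by (auto simp: F_def free_group_def dest: in_set_takeD)
    moreover have "\<exists>u\<in>U. h' = take ?i h \<otimes>\<^bsub>F\<^esub> u" if h': "h' \<in> carrier F" and eq: "key h' = key h" for h'
    proof
      have eqs: "length h' div r = length h div r" "take ?i h' = take ?i h"
        using eq by (auto simp: key_def)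
      have red: "h' \<in> lists (X \<times> UNIV)" "reduced_word (take ?i h' @ drop ?i h')"
        using h' by (auto simp: F_def free_group_def)
      have "length h' < Suc (length h div r) * r"
        using r0 eqs(1) by (metis dividend_less_div_times mult_Suc mult.commute add.commute)
      then have "length (drop ?i h') \<le> 2 * r"
        by (cases "length h div r") auto
      moreover have "drop ?i h' \<in> carrier F"
        using red reduced_word_append[OF red(2)]
        by (auto simp: F_def free_group_def dest: in_set_dropD)
      ultimately show "drop ?i h' \<in> U" by (simp add: U_def)
      show "h' = take ?i h \<otimes>\<^bsub>F\<^esub> drop ?i h'"
      proof -
        have "h' = foldr cancel_Cons (take ?i h') (drop ?i h')"
          using foldr_cancel_Cons_append[OF red(2)] by simp
        then show ?thesis unfolding eqs(2) by (simp add: F_def free_group_def)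
      qed
    qed
    ultimately show "\<exists>p\<in>carrier F. \<forall>h'\<in>carrier F. key h' = key h \<longrightarrow> (\<exists>u\<in>U. h' = p \<otimes>\<^bsub>F\<^esub> u)"
      by blast
  qed
qed

section \<open>Products of a lamplighter group with another group\<close>

locale lamplighter_times_group = H: group H + K: group K
  for H :: "('h, 'c) monoid_scheme" and K :: "('k, 'd) monoid_scheme"
begin

definition Q :: "((('h \<Rightarrow> int) \<times> 'h) \<times> 'k) monoid" where
  "Q = (integer_group wr H) \<times>\<times> K"

definition lamps :: "('h \<Rightarrow> int) set" where
  "lamps = {f \<in> extensional (carrier H). finite {x \<in> carrier H. f x \<noteq> 0}}"

sublocale Q: group Q
  unfolding Q_def
  by (intro DirProd_group group_wreath_product group_integer_group H.is_group K.is_group)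

lemma carrier_Q: "carrier Q = (lamps \<times> carrier H) \<times> carrier K"
  by (auto simp: Q_def wreath_product_def semidirect_product_def carrier_sum_group lamps_def PiE_def)

lemma mult_Q:
  "((f, h), g) \<otimes>\<^bsub>Q\<^esub> ((f', h'), g') =
     ((\<lambda>x\<in>carrier H. f x + f' (inv\<^bsub>H\<^esub> h \<otimes>\<^bsub>H\<^esub> x), h \<otimes>\<^bsub>H\<^esub> h'), g \<otimes>\<^bsub>K\<^esub> g')"
  by (auto simp: Q_def wreath_product_def semidirect_product_def shift_action_def fun_eq_iff)

lemma lamps_single: "(\<lambda>x\<in>carrier H. if x = e then n else 0) \<in> lamps"
proof -
  have "{x \<in> carrier H. (\<lambda>x\<in>carrier H. if x = e then n else 0) x \<noteq> 0} \<subseteq> {e}" by auto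
  from finite_subset[OF this] show ?thesis unfolding lamps_def by simp
qed

lemma lamps_diff:
  assumes "f \<in> lamps" "f' \<in> lamps"
  shows "(\<lambda>x\<in>carrier H. f x - f' x) \<in> lamps"
proof -
  have "{x \<in> carrier H. (\<lambda>x\<in>carrier H. f x - f' x) x \<noteq> 0} \<subseteq>
      {x \<in> carrier H. f x \<noteq> 0} \<union> {x \<in> carrier H. f' x \<noteq> 0}" by auto
  moreover have "finite ({x \<in> carrier H. f x \<noteq> 0} \<union> {x \<in> carrier H. f' x \<noteq> 0})"
    using assms by (simp add: lamps_def)
  ultimately have "finite {x \<in> carrier H. (\<lambda>x\<in>carrier H. f x - f' x) x \<noteq> 0}"
    by (rule finite_subset)
  then show ?thesis unfolding lamps_def by (intro CollectI conjI restrict_extensional)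
qed

text \<open>Left multiplication by a pure lamp configuration adds it pointwise and moves nothing
  else. Such translations normalise the lamps of a piece.\<close>

lemma mult_lamp_shift:
  assumes "f \<in> lamps" "h \<in> carrier H" "g \<in> carrier K"
  shows "((f, h), g) = ((f', \<one>\<^bsub>H\<^esub>), \<one>\<^bsub>K\<^esub>) \<otimes>\<^bsub>Q\<^esub> ((\<lambda>x\<in>carrier H. f x - f' x, h), g)"
  using assms by (auto simp: mult_Q fun_eq_iff lamps_def extensional_def)

lemma lamps_zero: "(\<lambda>x\<in>carrier H. 0) \<in> lamps"
  by (simp add: lamps_def)

end

locale lamplighter_product = lamplighter_times_group H K
  for H :: "('h, 'c) monoid_scheme" and K :: "('k, 'd) monoid_scheme" +
  fixes S :: "((('h \<Rightarrow> int) \<times> 'h) \<times> 'k) set"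
  assumes gen_Q: "finite_symmetric_generating_set Q S"
begin

abbreviation ball :: "real \<Rightarrow> ((('h \<Rightarrow> int) \<times> 'h) \<times> 'k) set" where
  "ball \<equiv> word_ball Q S"

abbreviation translates :: "((('h \<Rightarrow> int) \<times> 'h) \<times> 'k) set \<Rightarrow> ((('h \<Rightarrow> int) \<times> 'h) \<times> 'k) metric set" where
  "translates \<equiv> translate_family Q S"

section \<open>Splitting off the second factor and cutting the base group\<close>

lemma finite_ball: "finite (ball R)"
  by (rule Q.finite_word_ball[OF gen_Q])

lemma ball_subset: "ball R \<subseteq> carrier Q"
  by (auto simp: word_ball_def)

text \<open>\<open>Q\<close> is a countable union of finite balls and projects onto
  \<open>K\<close>. Greedy colouring needs an enumeration of \<open>K\<close>.\<close>

lemma countable_carrier_K: "countable (carrier K)"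
proof -
  have "carrier Q = (\<Union>n. ball (real n))"
    by (auto simp: word_ball_def)
  then have "countable (carrier Q)" by (simp add: finite_ball countable_finite)
  moreover have "carrier K = snd ` carrier Q"
    using lamps_zero H.one_closed by (force simp: carrier_Q)
  ultimately show ?thesis by simp
qed

text \<open>For \<open>U = carrier H\<close> this is the kernel of the projection to
  \<open>K\<close>. For finite \<open>U\<close> the position of the lamplighter is bounded while the
  lamps remain free.\<close>

definition lamplighter_slab :: "'h set \<Rightarrow> ((('h \<Rightarrow> int) \<times> 'h) \<times> 'k) set" where
  "lamplighter_slab U = (lamps \<times> U) \<times> {\<one>\<^bsub>K\<^esub>}"

lemma decompose_second_factor:
  assumes R: "R \<ge> 0"
  shows "family_decomposes_over (translates (carrier Q)) R (card (snd ` ball R) + 1)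
           (translates (lamplighter_slab (carrier H)))"
proof -
  let ?V = "snd ` ball R"
  let ?E = "\<lambda>x y. inv\<^bsub>K\<^esub> x \<otimes>\<^bsub>K\<^esub> y \<in> ?V \<and> x \<in> carrier K \<and> y \<in> carrier K"
  have V: "finite ?V" "?V \<subseteq> carrier K"
    using finite_ball ball_subset[of R] by (auto simp: carrier_Q)
  have invV: "inv\<^bsub>K\<^esub> v \<in> ?V" if v: "v \<in> ?V" for v
  proof -
    obtain z where z: "z \<in> ball R" "v = snd z" using v by auto
    have zC: "z \<in> carrier Q" using z ball_subset by auto
    have "snd (inv\<^bsub>Q\<^esub> z) = inv\<^bsub>K\<^esub> (snd z)"
      using zC group_wreath_product[OF group_integer_group H.is_group] K.is_group
      by (cases z) (simp add: Q_def)
    then show ?thesis using Q.inv_in_word_ball[OF gen_Q z(1)] z(2) by (metis image_eqI)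
  qed
  obtain col :: "'k \<Rightarrow> nat" where col: "\<And>x. x \<in> carrier K \<Longrightarrow> col x \<le> card ?V"
    "\<And>x y. x \<in> carrier K \<Longrightarrow> y \<in> carrier K \<Longrightarrow> ?E x y \<Longrightarrow> x \<noteq> y \<Longrightarrow> col x \<noteq> col y"
  proof (rule greedy_colouring[OF countable_carrier_K, of ?E "card ?V"])
    show "?E y x" if E: "?E x y" for x y
      using invV[of "inv\<^bsub>K\<^esub> x \<otimes>\<^bsub>K\<^esub> y"] E by (auto simp: K.inv_mult_group)
    show "finite {y \<in> carrier K. ?E x y} \<and> card {y \<in> carrier K. ?E x y} \<le> card ?V"
      if x: "x \<in> carrier K" for x
    proof -
      have "{y \<in> carrier K. ?E x y} \<subseteq> (\<lambda>v. x \<otimes>\<^bsub>K\<^esub> v) ` ?V"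
      proof
        fix y assume "y \<in> {y \<in> carrier K. ?E x y}"
        then show "y \<in> (\<lambda>v. x \<otimes>\<^bsub>K\<^esub> v) ` ?V"
          using x by (intro image_eqI[of _ _ "inv\<^bsub>K\<^esub> x \<otimes>\<^bsub>K\<^esub> y"]) (auto simp flip: K.m_assoc)
      qed
      then show ?thesis
        using V(1) by (meson card_image_le card_mono finite_imageI finite_subset order_trans)
    qed
  qed blast
  show ?thesis
  \<comment> \<open>The greedy colours start at 0, those of a decomposition at 1.\<close>
  proof (rule Q.translate_family_decomposes[OF gen_Q, where f = snd and c = "\<lambda>g. Suc (col g)"])
    show "Suc (col (snd x)) \<in> {1..card ?V + 1}" if "x \<in> carrier Q" for x
      using that col(1) by (auto simp: carrier_Q)
    show "snd x = snd (x \<otimes>\<^bsub>Q\<^esub> z)"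
      if xz: "x \<in> carrier Q" "z \<in> ball R" "Suc (col (snd x)) = Suc (col (snd (x \<otimes>\<^bsub>Q\<^esub> z)))" for x z
    proof (rule ccontr)
      assume neq: "snd x \<noteq> snd (x \<otimes>\<^bsub>Q\<^esub> z)"
      have z: "z \<in> carrier Q" using xz ball_subset by auto
      have snd_mult: "snd (x \<otimes>\<^bsub>Q\<^esub> z) = snd x \<otimes>\<^bsub>K\<^esub> snd z"
        by (cases x; cases z) (simp add: Q_def)
      have K: "snd x \<in> carrier K" "snd z \<in> carrier K" using xz z by (auto simp: carrier_Q)
      have "inv\<^bsub>K\<^esub> snd x \<otimes>\<^bsub>K\<^esub> (snd x \<otimes>\<^bsub>K\<^esub> snd z) = snd z"
        using K by (simp flip: K.m_assoc)
      then have "?E (snd x) (snd x \<otimes>\<^bsub>K\<^esub> snd z)" using K xz(2) by auto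
      then show False using col(2) neq xz(3) K by (auto simp: snd_mult)
    qed
    show "\<exists>x\<in>carrier Q. \<forall>z\<in>carrier Q. snd z = snd y \<longrightarrow>
            (\<exists>b\<in>lamplighter_slab (carrier H). z = x \<otimes>\<^bsub>Q\<^esub> b)"
      if y: "y \<in> carrier Q" for y
    proof (intro bexI ballI impI)
      let ?x = "((\<lambda>x\<in>carrier H. 0, \<one>\<^bsub>H\<^esub>), snd y)"
      show "?x \<in> carrier Q" using y lamps_zero by (auto simp: carrier_Q)
      fix z assume z: "z \<in> carrier Q" "snd z = snd y"
      then show "z = ?x \<otimes>\<^bsub>Q\<^esub> (fst z, \<one>\<^bsub>K\<^esub>)"
        using y by (auto simp: mult_Q carrier_Q fun_eq_iff lamps_def extensional_def)
      show "(fst z, \<one>\<^bsub>K\<^esub>) \<in> lamplighter_slab (carrier H)"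
        using z by (auto simp: lamplighter_slab_def carrier_Q)
    qed
  qed (auto simp: lamplighter_slab_def carrier_Q)
qed

text \<open>The colouring of \<open>H\<close> is pulled back along the position of the lamplighter.
  A key class lies in some \<open>p U\<close>, and translating by \<open>p\<close> with all lamps
  off moves it into the slab over \<open>U\<close>.\<close>

lemma decompose_base:
  fixes c :: "'y \<Rightarrow> nat"
  assumes c: "\<And>k. c k \<in> {1..2}"
    and U: "U \<subseteq> carrier H"
    and sep: "\<And>h t. h \<in> carrier H \<Longrightarrow> t \<in> (snd \<circ> fst) ` ball R \<Longrightarrow>
                c (key h) = c (key (h \<otimes>\<^bsub>H\<^esub> t)) \<Longrightarrow> key h = key (h \<otimes>\<^bsub>H\<^esub> t)"
    and piece: "\<And>h. h \<in> carrier H \<Longrightarrow>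
           \<exists>p\<in>carrier H. \<forall>h'\<in>carrier H. key h' = key h \<longrightarrow> (\<exists>u\<in>U. h' = p \<otimes>\<^bsub>H\<^esub> u)"
    and n: "2 \<le> n"
  shows "family_decomposes_over (translates (lamplighter_slab (carrier H))) R n
           (translates (lamplighter_slab U))"
proof (rule Q.translate_family_decomposes[OF gen_Q, where f = "\<lambda>x. key (snd (fst x))" and c = c])
  show "lamplighter_slab (carrier H) \<subseteq> carrier Q" "lamplighter_slab U \<subseteq> carrier Q"
    using U by (auto simp: lamplighter_slab_def carrier_Q)
  show "c (key (snd (fst x))) \<in> {1..n}" for x
    using c[of "key (snd (fst x))"] n by auto
  show "key (snd (fst x)) = key (snd (fst (x \<otimes>\<^bsub>Q\<^esub> z)))"
    if "x \<in> lamplighter_slab (carrier H)" "z \<in> ball R"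
      "c (key (snd (fst x))) = c (key (snd (fst (x \<otimes>\<^bsub>Q\<^esub> z))))" for x z
  proof -
    obtain f h g f' h' g' where xz: "x = ((f, h), g)" "z = ((f', h'), g')" by (metis surj_pair)
    have "snd (fst (x \<otimes>\<^bsub>Q\<^esub> z)) = snd (fst x) \<otimes>\<^bsub>H\<^esub> snd (fst z)"
      by (simp add: xz mult_Q)
    then show ?thesis
      using that sep[of "snd (fst x)" "snd (fst z)"] by (auto simp: lamplighter_slab_def)
  qed
  fix y assume "y \<in> lamplighter_slab (carrier H)"
  then have "snd (fst y) \<in> carrier H" by (auto simp: lamplighter_slab_def)
  from piece[OF this] obtain p where p: "p \<in> carrier H"
    "\<forall>h'\<in>carrier H. key h' = key (snd (fst y)) \<longrightarrow> (\<exists>u\<in>U. h' = p \<otimes>\<^bsub>H\<^esub> u)"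
    by (elim bexE)
  show "\<exists>x\<in>carrier Q. \<forall>z\<in>lamplighter_slab (carrier H). key (snd (fst z)) = key (snd (fst y)) \<longrightarrow>
          (\<exists>b\<in>lamplighter_slab U. z = x \<otimes>\<^bsub>Q\<^esub> b)"
  proof (rule bexI, intro ballI impI)
    let ?x = "((\<lambda>x\<in>carrier H. 0, p), \<one>\<^bsub>K\<^esub>)"
    show xC: "?x \<in> carrier Q" using p lamps_zero by (auto simp: carrier_Q)
    fix z assume z: "z \<in> lamplighter_slab (carrier H)" "key (snd (fst z)) = key (snd (fst y))"
    have zC: "z \<in> carrier Q" using z by (auto simp: lamplighter_slab_def carrier_Q)
    obtain u where u: "u \<in> U" "snd (fst z) = p \<otimes>\<^bsub>H\<^esub> u"
      using p(2) z by (auto simp: lamplighter_slab_def)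
    \<comment> \<open>The slab leaves the lamps free, so only the position and the second coordinate
      of the quotient have to be identified.\<close>
    define b where "b = inv\<^bsub>Q\<^esub> ?x \<otimes>\<^bsub>Q\<^esub> z"
    have bC: "b \<in> carrier Q" using xC zC by (simp add: b_def)
    have zb: "z = ?x \<otimes>\<^bsub>Q\<^esub> b" using xC zC by (simp add: b_def flip: Q.m_assoc)
    obtain f h g where b: "b = ((f, h), g)" by (metis surj_pair)
    have fhg: "f \<in> lamps" "h \<in> carrier H" "g \<in> carrier K" using bC by (auto simp: b carrier_Q)
    have "p \<otimes>\<^bsub>H\<^esub> h = p \<otimes>\<^bsub>H\<^esub> u" using u(2) by (simp add: zb b mult_Q)
    then have "h = u" using p(1) fhg(2) u(1) U by (simp add: subset_iff)
    moreover have "g = \<one>\<^bsub>K\<^esub>" using z(1) fhg(3) by (auto simp: zb b mult_Q lamplighter_slab_def)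
    ultimately have "b \<in> lamplighter_slab U" using fhg u by (auto simp: b lamplighter_slab_def)
    then show "\<exists>b\<in>lamplighter_slab U. z = ?x \<otimes>\<^bsub>Q\<^esub> b" using zb by blast
  qed
qed

section \<open>Bounding the lamps one at a time\<close>

text \<open>\<open>T\<close> holds the lamps whose values are still unbounded; each costs one further decomposition.\<close>

definition lamp_box :: "'h set \<Rightarrow> 'h set \<Rightarrow> 'h set \<Rightarrow> int \<Rightarrow> ((('h \<Rightarrow> int) \<times> 'h) \<times> 'k) set" where
  "lamp_box U E T M =
     ({f \<in> lamps. (\<forall>x\<in>carrier H - E. f x = 0) \<and> (\<forall>x\<in>carrier H - T. \<bar>f x\<bar> \<le> M)} \<times> U) \<times> {\<one>\<^bsub>K\<^esub>}"

lemma lamp_box_subset: "U \<subseteq> carrier H \<Longrightarrow> lamp_box U E T M \<subseteq> carrier Q"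
  by (auto simp: lamp_box_def carrier_Q)

lemma finite_lamp_box:
  assumes "finite U" "finite E"
  shows "finite (lamp_box U E {} M)"
proof -
  let ?ext = "\<lambda>v. \<lambda>x\<in>carrier H. if x \<in> E then v x else 0"
  \<comment> \<open>The interval contains 0 for every sign of \<open>M\<close>, as required by the
    extension by 0 at points of \<open>E\<close> outside the group.\<close>
  have "{f \<in> lamps. (\<forall>x\<in>carrier H - E. f x = 0) \<and> (\<forall>x\<in>carrier H - {}. \<bar>f x\<bar> \<le> M)} \<subseteq>
      ?ext ` (\<Pi>\<^sub>E x\<in>E. {min (- M) 0..max M 0})"
  proof
    fix f assume f: "f \<in> {f \<in> lamps. (\<forall>x\<in>carrier H - E. f x = 0) \<and> (\<forall>x\<in>carrier H - {}. \<bar>f x\<bar> \<le> M)}"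
    let ?v = "\<lambda>x\<in>E. if x \<in> carrier H then f x else 0"
    have "f = ?ext ?v" using f by (auto simp: fun_eq_iff lamps_def extensional_def)
    moreover have "?v \<in> (\<Pi>\<^sub>E x\<in>E. {min (- M) 0..max M 0})" using f by force
    ultimately show "f \<in> ?ext ` (\<Pi>\<^sub>E x\<in>E. {min (- M) 0..max M 0})" by (rule image_eqI)
  qed
  then have "finite {f \<in> lamps. (\<forall>x\<in>carrier H - E. f x = 0) \<and> (\<forall>x\<in>carrier H - {}. \<bar>f x\<bar> \<le> M)}"
    by (rule finite_subset) (intro finite_imageI finite_PiE assms finite_atLeastAtMost_int)
  then show ?thesis using assms by (simp add: lamp_box_def)
qed

text \<open>From a position \<open>u\<close> in \<open>U\<close> a ball element alters only lamps at
  \<open>u\<close> times a point of its support. These places form the finite set \<open>E\<close>,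
  so elements of the slab at distance at most \<open>R\<close> agree outside \<open>E\<close> and
  one colour is enough. Translating by the lamps of one member of a piece switches off all lamps
  outside \<open>E\<close>.\<close>

lemma decompose_lamp_support:
  assumes U: "finite U" "U \<subseteq> carrier H"
  obtains E where "finite E" "E \<subseteq> carrier H"
    and "\<And>n. 1 \<le> n \<Longrightarrow>
           family_decomposes_over (translates (lamplighter_slab U)) R n (translates (lamp_box U E E 0))"
proof -
  define E where "E = (\<Union>z\<in>ball R. \<Union>u\<in>U. (\<lambda>x. u \<otimes>\<^bsub>H\<^esub> x) ` {x \<in> carrier H. fst (fst z) x \<noteq> 0})"
  have "finite {x \<in> carrier H. fst (fst z) x \<noteq> 0}" if "z \<in> ball R" for z
    using that ball_subset[of R] by (auto simp: carrier_Q lamps_def)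
  then have finE: "finite E" unfolding E_def using U finite_ball by blast
  have EH: "E \<subseteq> carrier H" using U by (auto simp: E_def)
  show thesis
  proof
    show "finite E" "E \<subseteq> carrier H" by fact+
    fix n :: nat assume n: "1 \<le> n"
    show "family_decomposes_over (translates (lamplighter_slab U)) R n (translates (lamp_box U E E 0))"
    proof (rule Q.translate_family_decomposes[OF gen_Q,
          where f = "\<lambda>x. restrict (fst (fst x)) (carrier H - E)" and c = "\<lambda>_. 1"])
      show "lamplighter_slab U \<subseteq> carrier Q" "lamp_box U E E 0 \<subseteq> carrier Q"
        using U lamp_box_subset by (auto simp: lamplighter_slab_def carrier_Q)
      show "restrict (fst (fst x)) (carrier H - E) = restrict (fst (fst (x \<otimes>\<^bsub>Q\<^esub> z))) (carrier H - E)"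
        if x: "x \<in> lamplighter_slab U" and z: "z \<in> ball R" for x z
      proof (rule restrict_ext)
        fix y assume y: "y \<in> carrier H - E"
        obtain f u where fu: "x = ((f, u), \<one>\<^bsub>K\<^esub>)" "u \<in> U"
          using x by (auto simp: lamplighter_slab_def)
        obtain \<phi> t g where tg: "z = ((\<phi>, t), g)" by (metis surj_pair)
        have u: "u \<in> carrier H" using fu U by auto
        have "\<phi> (inv\<^bsub>H\<^esub> u \<otimes>\<^bsub>H\<^esub> y) = 0"
        proof (rule ccontr)
          assume "\<phi> (inv\<^bsub>H\<^esub> u \<otimes>\<^bsub>H\<^esub> y) \<noteq> 0"
          then have "inv\<^bsub>H\<^esub> u \<otimes>\<^bsub>H\<^esub> y \<in> {x \<in> carrier H. fst (fst z) x \<noteq> 0}"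
            using u y by (simp add: tg)
          moreover have "y = u \<otimes>\<^bsub>H\<^esub> (inv\<^bsub>H\<^esub> u \<otimes>\<^bsub>H\<^esub> y)" using u y by (simp flip: H.m_assoc)
          ultimately have "y \<in> E" unfolding E_def using z fu(2) by blast
          then show False using y by simp
        qed
        then show "fst (fst x) y = fst (fst (x \<otimes>\<^bsub>Q\<^esub> z)) y"
          using y by (simp add: fu tg mult_Q)
      qed
      fix y assume y: "y \<in> lamplighter_slab U"
      show "\<exists>x\<in>carrier Q. \<forall>z\<in>lamplighter_slab U.
          restrict (fst (fst z)) (carrier H - E) = restrict (fst (fst y)) (carrier H - E) \<longrightarrow>
          (\<exists>b\<in>lamp_box U E E 0. z = x \<otimes>\<^bsub>Q\<^esub> b)"
      proof (rule bexI, intro ballI impI)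
        let ?f = "fst (fst y)"
        show "((?f, \<one>\<^bsub>H\<^esub>), \<one>\<^bsub>K\<^esub>) \<in> carrier Q"
          using y by (auto simp: lamplighter_slab_def carrier_Q)
        fix z assume z: "z \<in> lamplighter_slab U"
          and eq: "restrict (fst (fst z)) (carrier H - E) = restrict ?f (carrier H - E)"
        obtain f u where fu: "z = ((f, u), \<one>\<^bsub>K\<^esub>)" "u \<in> U" "f \<in> lamps"
          using z by (auto simp: lamplighter_slab_def)
        have "f x = ?f x" if "x \<in> carrier H - E" for x
          using fun_cong[OF eq, of x] that by (simp add: fu)
        moreover have "?f \<in> lamps" using y by (auto simp: lamplighter_slab_def)
        ultimately have "((\<lambda>x\<in>carrier H. f x - ?f x, u), \<one>\<^bsub>K\<^esub>) \<in> lamp_box U E E 0"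
          using fu lamps_diff[of f ?f] by (auto simp: lamp_box_def)
        moreover have "z = ((?f, \<one>\<^bsub>H\<^esub>), \<one>\<^bsub>K\<^esub>) \<otimes>\<^bsub>Q\<^esub> ((\<lambda>x\<in>carrier H. f x - ?f x, u), \<one>\<^bsub>K\<^esub>)"
          using mult_lamp_shift[of f u "\<one>\<^bsub>K\<^esub>"] fu U by auto
        ultimately show "\<exists>b\<in>lamp_box U E E 0. z = ((?f, \<one>\<^bsub>H\<^esub>), \<one>\<^bsub>K\<^esub>) \<otimes>\<^bsub>Q\<^esub> b" by blast
      qed
    qed (use n in auto)
  qed
qed

text \<open>The value of the lamp at \<open>e\<close> is treated as a point of the integers:
  intervals of length \<open>r\<close>, coloured by parity. Translating by the left end of the
  interval leaves a value between 0 and \<open>r\<close>.\<close>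

lemma decompose_lamp:
  assumes U: "finite U" "U \<subseteq> carrier H" and e: "e \<in> E" "E \<subseteq> carrier H"
  obtains M' where
    "\<And>n. 2 \<le> n \<Longrightarrow>
       family_decomposes_over (translates (lamp_box U E (insert e T) M)) R n
         (translates (lamp_box U E T M'))"
proof -
  \<comment> \<open>Right multiplication by \<open>z\<close> at position \<open>u\<close> changes
    the lamp at \<open>e\<close> by the value of \<open>z\<close> at \<open>inv u e\<close>. The
    summand 1 makes \<open>r\<close> positive and larger than every such change;
    \<open>insert 0\<close> covers an empty \<open>U\<close>.\<close>
  define r where "r = 1 + Max (insert 0 ((\<lambda>(z, u). \<bar>fst (fst z) (inv\<^bsub>H\<^esub> u \<otimes>\<^bsub>H\<^esub> e)\<bar>) ` (ball R \<times> U)))"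
  have r: "\<bar>fst (fst z) (inv\<^bsub>H\<^esub> u \<otimes>\<^bsub>H\<^esub> e)\<bar> < r" if "z \<in> ball R" "u \<in> U" for z u
  proof -
    have "\<bar>fst (fst z) (inv\<^bsub>H\<^esub> u \<otimes>\<^bsub>H\<^esub> e)\<bar> \<le>
        Max (insert 0 ((\<lambda>(z, u). \<bar>fst (fst z) (inv\<^bsub>H\<^esub> u \<otimes>\<^bsub>H\<^esub> e)\<bar>) ` (ball R \<times> U)))"
      using that U finite_ball by (intro Max_ge) force+
    then show ?thesis by (simp add: r_def)
  qed
  have r0: "r > 0"
  proof -
    have "0 \<le> Max (insert 0 ((\<lambda>(z, u). \<bar>fst (fst z) (inv\<^bsub>H\<^esub> u \<otimes>\<^bsub>H\<^esub> e)\<bar>) ` (ball R \<times> U)))"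
      using U finite_ball by (intro Max_ge) auto
    then show ?thesis by (simp add: r_def)
  qed
  show thesis
  proof
    fix n :: nat assume n: "2 \<le> n"
    show "family_decomposes_over (translates (lamp_box U E (insert e T) M)) R n
        (translates (lamp_box U E T (max M r)))"
    proof (rule Q.translate_family_decomposes[OF gen_Q,
          where f = "\<lambda>x. fst (fst x) e div r" and c = "\<lambda>k. Suc (nat (k mod 2))"])
      show "lamp_box U E (insert e T) M \<subseteq> carrier Q" "lamp_box U E T (max M r) \<subseteq> carrier Q"
        using U lamp_box_subset by auto
      show "Suc (nat (fst (fst x) e div r mod 2)) \<in> {1..n}" for x
        using n pos_mod_bound[of 2 "fst (fst x) e div r"] by simp
      show "fst (fst x) e div r = fst (fst (x \<otimes>\<^bsub>Q\<^esub> z)) e div r"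
        if x: "x \<in> lamp_box U E (insert e T) M" and z: "z \<in> ball R"
          and c: "Suc (nat (fst (fst x) e div r mod 2)) = Suc (nat (fst (fst (x \<otimes>\<^bsub>Q\<^esub> z)) e div r mod 2))"
        for x z
      proof -
        obtain f u where fu: "x = ((f, u), \<one>\<^bsub>K\<^esub>)" "u \<in> U"
          using x by (auto simp: lamp_box_def)
        obtain \<phi> t g where tg: "z = ((\<phi>, t), g)" by (metis surj_pair)
        define m where "m = f e"
        define m' where "m' = fst (fst (x \<otimes>\<^bsub>Q\<^esub> z)) e"
        have "m' = m + \<phi> (inv\<^bsub>H\<^esub> u \<otimes>\<^bsub>H\<^esub> e)"
          using e by (auto simp: m_def m'_def fu tg mult_Q)
        then have "m' \<le> m + r" "m \<le> m' + r" using r[OF z fu(2)] by (auto simp: tg)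
        from zdiv_mono1[OF this(1) r0] zdiv_mono1[OF this(2) r0]
        have "m' div r \<le> m div r + 1" "m div r \<le> m' div r + 1"
          using r0 by simp_all
        moreover have "m div r mod 2 = m' div r mod 2"
          using c pos_mod_sign[of 2 "m div r"] pos_mod_sign[of 2 "m' div r"]
          unfolding fu(1) m_def m'_def by (simp add: eq_nat_nat_iff)
        moreover have "a = b" if "a \<le> b + 1" "b \<le> a + 1" "b mod 2 = a mod 2" for a b :: int
          using that by presburger
        ultimately have "m div r = m' div r" by metis
        then show ?thesis by (simp add: fu(1) m_def m'_def)
      qed
      fix y assume "y \<in> lamp_box U E (insert e T) M"
      define k where "k = fst (fst y) e div r"
      show "\<exists>x\<in>carrier Q. \<forall>z\<in>lamp_box U E (insert e T) M. fst (fst z) e div r = fst (fst y) e div r \<longrightarrow>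
          (\<exists>b\<in>lamp_box U E T (max M r). z = x \<otimes>\<^bsub>Q\<^esub> b)"
        unfolding k_def[symmetric]
      proof (rule bexI, intro ballI impI)
        let ?f = "\<lambda>x\<in>carrier H. if x = e then k * r else 0"
        show "((?f, \<one>\<^bsub>H\<^esub>), \<one>\<^bsub>K\<^esub>) \<in> carrier Q"
          using lamps_single by (simp add: carrier_Q)
        fix z assume z: "z \<in> lamp_box U E (insert e T) M" and eq: "fst (fst z) e div r = k"
        obtain f u where fu: "z = ((f, u), \<one>\<^bsub>K\<^esub>)" "u \<in> U" "f \<in> lamps"
          "\<And>x. x \<in> carrier H - E \<Longrightarrow> f x = 0" "\<And>x. x \<in> carrier H - insert e T \<Longrightarrow> \<bar>f x\<bar> \<le> M"
          using z by (auto simp: lamp_box_def)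
        let ?f' = "\<lambda>x\<in>carrier H. f x - ?f x"
        \<comment> \<open>What remains of the lamp is a remainder modulo \<open>r\<close>, hence
          bounded.\<close>
        have "f e - k * r = f e mod r" using eq by (simp add: fu(1) minus_div_mult_eq_mod flip: eq)
        then have "0 \<le> f e - k * r" "f e - k * r < r" using r0 by simp_all
        then have "\<bar>?f' x\<bar> \<le> max M r" if "x \<in> carrier H - T" for x
          using fu(5)[of x] that by (cases "x = e") auto
        moreover have "?f' x = 0" if "x \<in> carrier H - E" for x
          using fu(4)[OF that] e that by auto
        moreover have "?f' \<in> lamps" using lamps_diff[OF fu(3) lamps_single] .
        ultimately have "((?f', u), \<one>\<^bsub>K\<^esub>) \<in> lamp_box U E T (max M r)"
          using fu(2) unfolding lamp_box_def by blast
        moreover have "z = ((?f, \<one>\<^bsub>H\<^esub>), \<one>\<^bsub>K\<^esub>) \<otimes>\<^bsub>Q\<^esub> ((?f', u), \<one>\<^bsub>K\<^esub>)"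
          using mult_lamp_shift[of f u "\<one>\<^bsub>K\<^esub>" ?f] fu(1,2,3) U by auto
        ultimately show "\<exists>b\<in>lamp_box U E T (max M r). z = ((?f, \<one>\<^bsub>H\<^esub>), \<one>\<^bsub>K\<^esub>) \<otimes>\<^bsub>Q\<^esub> b" by blast
      qed
    qed
  qed
qed

text \<open>Each lamp in \<open>T\<close> uses up one radius and may enlarge the bound, so
  \<open>M\<close> and \<open>R\<close> vary in the induction. Once \<open>T\<close> is empty the
  box is finite.\<close>

lemma decomposition_chain_lamp_box:
  assumes U: "finite U" "U \<subseteq> carrier H" and E: "finite E" "E \<subseteq> carrier H"
    and s: "\<And>R. 0 < R \<Longrightarrow> 2 \<le> s R" and R: "\<And>i. 0 < R i" and T: "T \<subseteq> E"
  shows "decomposition_chain s R (translates (lamp_box U E T M))"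
proof -
  have "finite T" using T E finite_subset by blast
  then show ?thesis using T R
  proof (induction T arbitrary: M R)
    case empty
    show ?case
      by (intro decomposition_chain_0 Q.uniformly_bounded_translate_family[OF gen_Q]
          lamp_box_subset finite_lamp_box U E)
  next
    case (insert e T)
    obtain M' where "\<And>n. 2 \<le> n \<Longrightarrow> family_decomposes_over (translates (lamp_box U E (insert e T) M)) (R 0) n
         (translates (lamp_box U E T M'))"
      using decompose_lamp[OF U, of e E] insert.prems E by blast
    then show ?case
      using insert s by (intro decomposition_chain_step[of _ R s "translates (lamp_box U E T M')"]) auto
  qed
qed

end

section \<open>Generating sets\<close>

lemma (in group) ex_finite_symmetric_generating_set:
  assumes S: "finite S" "S \<subseteq> carrier G" "generate G S = carrier G"
  shows "\<exists>S. finite_symmetric_generating_set G S"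
proof -
  let ?S = "S \<union> m_inv G ` S"
  have sub: "?S \<subseteq> carrier G" using S(2) by auto
  have "carrier G \<subseteq> generate G ?S"
    using mono_generate[of S ?S] S(3) by simp
  then have "generate G ?S = carrier G"
    using generate_incl[OF sub] by (intro subset_antisym)
  moreover have "inv x \<in> ?S" if "x \<in> ?S" for x
    using that S(2) by (auto simp: subset_iff)
  moreover have "finite ?S" using S(1) by simp
  ultimately show ?thesis
    unfolding finite_symmetric_generating_set_def using sub by (intro exI[of _ ?S] conjI ballI)
qed

lemma generate_free_group: "generate (free_group X) ((\<lambda>l. [l]) ` (X \<times> UNIV)) = carrier (free_group X)"
proof
  let ?S = "(\<lambda>l. [l]) ` (X \<times> (UNIV :: bool set))"
  show "generate (free_group X) ?S \<subseteq> carrier (free_group X)"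
    by (rule group.generate_incl[OF group_free_group]) (auto simp: free_group_def)
  show "carrier (free_group X) \<subseteq> generate (free_group X) ?S"
  proof
    fix w assume "w \<in> carrier (free_group X)"
    then have "w \<in> lists (X \<times> UNIV)" "reduced_word w" by (auto simp: free_group_def)
    then show "w \<in> generate (free_group X) ?S"
    proof (induction w)
      case Nil
      show ?case using generate.one[of "free_group X" ?S] by (simp add: free_group_def)
    next
      case (Cons l w)
      have "[l] \<otimes>\<^bsub>free_group X\<^esub> w \<in> generate (free_group X) ?S"
      proof (rule generate.eng)
        show "[l] \<in> generate (free_group X) ?S"
          using Cons.hyps by (intro generate.incl imageI)
        show "w \<in> generate (free_group X) ?S"
          by (rule Cons.IH[OF reduced_word_tl[OF Cons.prems]])
      qed
      then show ?case using Cons.prems by (simp add: free_group_def cancel_Cons_reduced)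
    qed
  qed
qed

lemma generate_Grigorchuk_group:
  "generate Grigorchuk_group {grig_a, grig_b, grig_c, grig_d} = carrier Grigorchuk_group"
proof -
  interpret T: group tree_Aut by (rule group_tree_Aut)
  let ?S = "{grig_a, grig_b, grig_c, grig_d}"
  have "?S \<subseteq> carrier Grigorchuk_group"
    unfolding Grigorchuk_group_def using T.subgroup_generated_subset_carrier_subset[OF grig_in_tree_Aut] .
  moreover have "carrier Grigorchuk_group = generate Grigorchuk_group (carrier Grigorchuk_group \<inter> ?S)"
    unfolding Grigorchuk_group_def
    by (subst T.subgroup_generated2[symmetric]) (simp only: carrier_subgroup_generated)
  ultimately show ?thesis by (simp add: Int_absorb1)
qed

text \<open>Besides the generators of both groups one lamp of value 1 at the identity suffices: its
  powers give every value there, conjugation carries them to other places, and products give all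
  finite configurations.\<close>

lemma (in lamplighter_times_group) ex_finite_symmetric_generating_set_Q:
  assumes SH: "finite SH" "SH \<subseteq> carrier H" "generate H SH = carrier H"
    and SK: "finite SK" "SK \<subseteq> carrier K" "generate K SK = carrier K"
  shows "\<exists>S. finite_symmetric_generating_set Q S"
proof -
  define O0 :: "'h \<Rightarrow> int" where "O0 = (\<lambda>x\<in>carrier H. 0)"
  define single :: "'h \<Rightarrow> int \<Rightarrow> 'h \<Rightarrow> int" where "single e n = (\<lambda>x\<in>carrier H. if x = e then n else 0)" for e n
  define S0 where "S0 = (\<lambda>h. ((O0, h), \<one>\<^bsub>K\<^esub>)) ` SH \<union> (\<lambda>g. ((O0, \<one>\<^bsub>H\<^esub>), g)) ` SK \<union>
    {((single \<one>\<^bsub>H\<^esub> 1, \<one>\<^bsub>H\<^esub>), \<one>\<^bsub>K\<^esub>)}"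
  have lamps0: "O0 \<in> lamps" "single e n \<in> lamps" for e n
    using lamps_zero lamps_single by (auto simp: O0_def single_def)
  have S0: "finite S0" "S0 \<subseteq> carrier Q"
    using SH SK lamps0 by (auto simp: S0_def carrier_Q)
  let ?M = "generate Q S0"
  have M: "subgroup ?M Q" by (rule Q.generate_is_subgroup[OF S0(2)])
  have one: "\<one>\<^bsub>Q\<^esub> = ((O0, \<one>\<^bsub>H\<^esub>), \<one>\<^bsub>K\<^esub>)"
    by (simp add: Q_def wreath_product_def semidirect_product_def O0_def)
  note mult = subgroup.m_closed[OF M] and inv = subgroup.m_inv_closed[OF M]
  have base: "((O0, h), \<one>\<^bsub>K\<^esub>) \<in> ?M" if h: "h \<in> carrier H" for h
  proof -
    have "h \<in> generate H SH" using h SH by simp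
    then show ?thesis
    proof induction
      case one
      then show ?case using subgroup.one_closed[OF M] by (simp add: \<open>\<one>\<^bsub>Q\<^esub> = _\<close>)
    next
      case (incl h)
      then show ?case by (intro generate.incl) (simp add: S0_def)
    next
      case (inv h)
      then have h: "h \<in> carrier H" using SH by auto
      have "inv\<^bsub>Q\<^esub> ((O0, h), \<one>\<^bsub>K\<^esub>) = ((O0, inv\<^bsub>H\<^esub> h), \<one>\<^bsub>K\<^esub>)"
        using h lamps0 by (intro Q.inv_equality) (auto simp: mult_Q carrier_Q one O0_def)
      moreover have "inv\<^bsub>Q\<^esub> ((O0, h), \<one>\<^bsub>K\<^esub>) \<in> ?M"
        using inv by (intro generate.inv) (simp add: S0_def)
      ultimately show ?case by simp
    next
      case (eng h1 h2)
      then have h: "h1 \<in> carrier H" "h2 \<in> carrier H" using SH by auto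
      have "((O0, h1 \<otimes>\<^bsub>H\<^esub> h2), \<one>\<^bsub>K\<^esub>) = ((O0, h1), \<one>\<^bsub>K\<^esub>) \<otimes>\<^bsub>Q\<^esub> ((O0, h2), \<one>\<^bsub>K\<^esub>)"
        using h by (auto simp: mult_Q O0_def)
      then show ?case using mult eng.IH by simp
    qed
  qed
  have second: "((O0, \<one>\<^bsub>H\<^esub>), g) \<in> ?M" if g: "g \<in> carrier K" for g
  proof -
    have "g \<in> generate K SK" using g SK by simp
    then show ?thesis
    proof induction
      case one
      then show ?case using subgroup.one_closed[OF M] by (simp add: \<open>\<one>\<^bsub>Q\<^esub> = _\<close>)
    next
      case (incl g)
      then show ?case by (intro generate.incl) (simp add: S0_def)
    next
      case (inv g)
      then have g: "g \<in> carrier K" using SK by auto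
      have "inv\<^bsub>Q\<^esub> ((O0, \<one>\<^bsub>H\<^esub>), g) = ((O0, \<one>\<^bsub>H\<^esub>), inv\<^bsub>K\<^esub> g)"
        using g lamps0 by (intro Q.inv_equality) (auto simp: mult_Q carrier_Q one O0_def)
      moreover have "inv\<^bsub>Q\<^esub> ((O0, \<one>\<^bsub>H\<^esub>), g) \<in> ?M"
        using inv by (intro generate.inv) (simp add: S0_def)
      ultimately show ?case by simp
    next
      case (eng g1 g2)
      then have g: "g1 \<in> carrier K" "g2 \<in> carrier K" using SK by auto
      have "((O0, \<one>\<^bsub>H\<^esub>), g1 \<otimes>\<^bsub>K\<^esub> g2) = ((O0, \<one>\<^bsub>H\<^esub>), g1) \<otimes>\<^bsub>Q\<^esub> ((O0, \<one>\<^bsub>H\<^esub>), g2)"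
        using g by (auto simp: mult_Q O0_def)
      then show ?case using mult eng.IH by simp
    qed
  qed
  have lamp: "((single \<one>\<^bsub>H\<^esub> n, \<one>\<^bsub>H\<^esub>), \<one>\<^bsub>K\<^esub>) \<in> ?M" for n
  proof -
    have gen: "((single \<one>\<^bsub>H\<^esub> 1, \<one>\<^bsub>H\<^esub>), \<one>\<^bsub>K\<^esub>) \<in> ?M"
      by (intro generate.incl) (simp add: S0_def)
    have add: "((single \<one>\<^bsub>H\<^esub> (m + n), \<one>\<^bsub>H\<^esub>), \<one>\<^bsub>K\<^esub>) =
        ((single \<one>\<^bsub>H\<^esub> m, \<one>\<^bsub>H\<^esub>), \<one>\<^bsub>K\<^esub>) \<otimes>\<^bsub>Q\<^esub> ((single \<one>\<^bsub>H\<^esub> n, \<one>\<^bsub>H\<^esub>), \<one>\<^bsub>K\<^esub>)" for m n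
      by (auto simp: mult_Q single_def)
    have zero: "single \<one>\<^bsub>H\<^esub> 0 = O0" by (auto simp: single_def O0_def)
    have "inv\<^bsub>Q\<^esub> ((single \<one>\<^bsub>H\<^esub> 1, \<one>\<^bsub>H\<^esub>), \<one>\<^bsub>K\<^esub>) = ((single \<one>\<^bsub>H\<^esub> (- 1), \<one>\<^bsub>H\<^esub>), \<one>\<^bsub>K\<^esub>)"
      using lamps0 by (intro Q.inv_equality) (auto simp: carrier_Q one zero simp flip: add)
    then have gen': "((single \<one>\<^bsub>H\<^esub> (- 1), \<one>\<^bsub>H\<^esub>), \<one>\<^bsub>K\<^esub>) \<in> ?M"
      using inv[OF gen] by simp
    show ?thesis
    proof (induction n rule: int_induct[where k = 0])
      case base
      show ?case using subgroup.one_closed[OF M] by (simp add: one zero)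
    next
      case (step1 i)
      then show ?case unfolding add using mult gen by blast
    next
      case (step2 i)
      then show ?case unfolding diff_conv_add_uminus add using mult gen' by blast
    qed
  qed
  have lamp_at: "((single e n, \<one>\<^bsub>H\<^esub>), \<one>\<^bsub>K\<^esub>) \<in> ?M" if e: "e \<in> carrier H" for e n
  proof -
    have eq: "inv\<^bsub>H\<^esub> e \<otimes>\<^bsub>H\<^esub> x = \<one>\<^bsub>H\<^esub> \<longleftrightarrow> x = e" if "x \<in> carrier H" for x
      using e that by (metis H.inv_closed H.inv_equality H.inv_inv H.l_inv)
    \<comment> \<open>Conjugation by the base element \<open>e\<close> moves the lamp from the
      identity to \<open>e\<close>.\<close>
    have "((single e n, \<one>\<^bsub>H\<^esub>), \<one>\<^bsub>K\<^esub>) =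
        ((O0, e), \<one>\<^bsub>K\<^esub>) \<otimes>\<^bsub>Q\<^esub> (((single \<one>\<^bsub>H\<^esub> n, \<one>\<^bsub>H\<^esub>), \<one>\<^bsub>K\<^esub>) \<otimes>\<^bsub>Q\<^esub> ((O0, inv\<^bsub>H\<^esub> e), \<one>\<^bsub>K\<^esub>))"
      using e by (auto simp: mult_Q single_def O0_def eq)
    then show ?thesis using mult base[OF e] base[of "inv\<^bsub>H\<^esub> e"] lamp e by simp
  qed
  have lamps: "((f, \<one>\<^bsub>H\<^esub>), \<one>\<^bsub>K\<^esub>) \<in> ?M" if f: "f \<in> lamps" for f
  proof -
    have "finite {x \<in> carrier H. f x \<noteq> 0}" using f by (simp add: lamps_def)
    \<comment> \<open>Induction over a finite set containing the support: the lamp at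
      \<open>e\<close> is split off as a factor.\<close>
    moreover have "\<forall>f. f \<in> lamps \<longrightarrow> {x \<in> carrier H. f x \<noteq> 0} \<subseteq> T \<longrightarrow> ((f, \<one>\<^bsub>H\<^esub>), \<one>\<^bsub>K\<^esub>) \<in> ?M"
      if "finite T" for T
      using that
    proof (induction T)
      case empty
      show ?case
      proof (intro allI impI)
        fix f assume "f \<in> lamps" "{x \<in> carrier H. f x \<noteq> 0} \<subseteq> {}"
        then have "f = O0" by (auto simp: O0_def fun_eq_iff lamps_def extensional_def)
        then show "((f, \<one>\<^bsub>H\<^esub>), \<one>\<^bsub>K\<^esub>) \<in> ?M" using subgroup.one_closed[OF M] by (simp add: one)
      qed
    next
      case (insert e T)
      show ?case
      proof (intro allI impI)
        fix f assume f: "f \<in> lamps" "{x \<in> carrier H. f x \<noteq> 0} \<subseteq> insert e T"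
        show "((f, \<one>\<^bsub>H\<^esub>), \<one>\<^bsub>K\<^esub>) \<in> ?M"
        proof (cases "e \<in> carrier H")
          case False
          then have "{x \<in> carrier H. f x \<noteq> 0} \<subseteq> T" using f by auto
          then show ?thesis using insert.IH f by blast
        next
          case True
          let ?f' = "\<lambda>x\<in>carrier H. f x - single e (f e) x"
          have "?f' \<in> lamps" using f lamps0 by (intro lamps_diff)
          moreover have "{x \<in> carrier H. ?f' x \<noteq> 0} \<subseteq> T" using f(2) by (auto simp: single_def)
          ultimately have "((?f', \<one>\<^bsub>H\<^esub>), \<one>\<^bsub>K\<^esub>) \<in> ?M" using insert.IH by blast
          then show ?thesis
            using mult[OF lamp_at[OF True, of "f e"]] f(1)
            by (subst mult_lamp_shift[of f _ _ "single e (f e)"]) auto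
        qed
      qed
    qed
    ultimately show ?thesis using f by blast
  qed
  have "carrier Q \<subseteq> ?M"
  proof
    fix x assume "x \<in> carrier Q"
    then obtain f h g where x: "x = ((f, h), g)" "f \<in> lamps" "h \<in> carrier H" "g \<in> carrier K"
      by (auto simp: carrier_Q)
    have "x = ((f, \<one>\<^bsub>H\<^esub>), \<one>\<^bsub>K\<^esub>) \<otimes>\<^bsub>Q\<^esub> (((O0, h), \<one>\<^bsub>K\<^esub>) \<otimes>\<^bsub>Q\<^esub> ((O0, \<one>\<^bsub>H\<^esub>), g))"
      using x by (auto simp: mult_Q O0_def fun_eq_iff lamps_def extensional_def)
    then show "x \<in> ?M" using mult lamps[OF x(2)] base[OF x(3)] second[OF x(4)] by simp
  qed
  then show ?thesis
    using Q.ex_finite_symmetric_generating_set[OF S0] Q.generate_incl[OF S0(2)] by blast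
qed

section \<open>Decomposition growth of the product\<close>

text \<open>Order of the steps: split off \<open>K\<close>, cut the tree, fix the lamps outside a
  finite set, then bound one lamp per step.\<close>

lemma free_lamplighter_growth_function:
  fixes X :: "'x set" and K :: "('k, 'd) monoid_scheme"
  defines "Q \<equiv> (integer_group wr free_group X) \<times>\<times> K"
  assumes X: "finite X" and K: "group K" and gen: "finite_symmetric_generating_set Q S"
  shows "decomposition_growth_function (word_metric Q S) (\<lambda>R. card (snd ` word_ball Q S R) + 1)"
proof -
  interpret L0: lamplighter_times_group "free_group X" K
    by (intro lamplighter_times_group.intro group_free_group K)
  have Q: "L0.Q = Q" by (simp add: L0.Q_def Q_def)
  interpret L: lamplighter_product "free_group X" K S
    by unfold_locales (use gen in \<open>simp add: Q\<close>)
  let ?s = "\<lambda>R. card (snd ` L.ball R) + 1"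
  have s2: "2 \<le> ?s R" if "0 < R" for R
  proof -
    have "snd ` L.ball R \<noteq> {}" using L0.Q.one_in_word_ball[of R S] that by auto
    then have "0 < card (snd ` L.ball R)" using L.finite_ball by (simp add: card_gt_0_iff)
    then show ?thesis by simp
  qed
  have "decomposition_growth_function (word_metric L0.Q S) ?s"
  proof (rule decomposition_growth_functionI[where \<W> = "L.translates (L.lamplighter_slab (carrier (free_group X)))"])
    show "mono_on {0<..} ?s"
      using L.finite_ball by (intro mono_onI add_mono card_mono image_mono L0.Q.word_ball_mono) auto
    fix R :: real assume "0 < R"
    have "submetric (word_metric L0.Q S) (carrier L0.Q) \<in> L.translates (carrier L0.Q)"
      unfolding translate_family_def using L0.Q.one_closed
      by (fastforce simp: image_iff intro!: exI[of _ "carrier L0.Q"] exI[of _ "\<one>\<^bsub>L0.Q\<^esub>"])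
    then have "word_metric L0.Q S \<in> L.translates (carrier L0.Q)"
      using submetric_mspace[of "word_metric L0.Q S"] by (simp add: L0.Q.mspace_word_metric[OF L.gen_Q])
    then show "family_decomposes_over {word_metric L0.Q S} R (?s R)
        (L.translates (L.lamplighter_slab (carrier (free_group X))))"
      using L.decompose_second_factor[of R] \<open>0 < R\<close> by (simp add: family_decomposes_over_def)
  next
    fix R :: "nat \<Rightarrow> real" assume R: "\<And>i. 0 < R i"
    have T: "finite ((snd \<circ> fst) ` L.ball (R 0))" using L.finite_ball by simp
    obtain c :: "nat \<times> ('x \<times> bool) list \<Rightarrow> nat" and key U where
      c: "\<And>k. c k \<in> {1..2}" and U: "finite U" "U \<subseteq> carrier (free_group X)" and
      sep: "\<And>h t. h \<in> carrier (free_group X) \<Longrightarrow> t \<in> (snd \<circ> fst) ` L.ball (R 0) \<Longrightarrow>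
             c (key h) = c (key (h \<otimes>\<^bsub>free_group X\<^esub> t)) \<Longrightarrow> key h = key (h \<otimes>\<^bsub>free_group X\<^esub> t)" and
      piece: "\<And>h. h \<in> carrier (free_group X) \<Longrightarrow> \<exists>p\<in>carrier (free_group X).
             \<forall>h'\<in>carrier (free_group X). key h' = key h \<longrightarrow> (\<exists>u\<in>U. h' = p \<otimes>\<^bsub>free_group X\<^esub> u)"
      by (rule free_group_colouring[OF X T], rule that)
    \<comment> \<open>\<open>E\<close> depends on \<open>U\<close> and on the next radius. One step
      per lamp in \<open>E\<close> follows, so the length of the chain is known only after these
      radii.\<close>
    obtain E where E: "finite E" "E \<subseteq> carrier (free_group X)"
      "\<And>n. 1 \<le> n \<Longrightarrow> family_decomposes_over (L.translates (L.lamplighter_slab U)) (R (Suc 0)) n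
         (L.translates (L.lamp_box U E E 0))"
      by (rule L.decompose_lamp_support[OF U, where R = "R (Suc 0)"], rule that)
    have chain2: "decomposition_chain ?s (\<lambda>i. R (Suc (Suc i))) (L.translates (L.lamp_box U E E 0))"
      by (rule L.decomposition_chain_lamp_box[OF U E(1,2)]) (use s2 R in auto)
    have chain1: "decomposition_chain ?s (\<lambda>i. R (Suc i)) (L.translates (L.lamplighter_slab U))"
      by (rule decomposition_chain_step[where R = "\<lambda>i. R (Suc i)", OF _ chain2]) (rule E(3), simp)
    have base: "family_decomposes_over (L.translates (L.lamplighter_slab (carrier (free_group X))))
        (R 0) (?s (R 0)) (L.translates (L.lamplighter_slab U))"
    proof (rule L.decompose_base)
      show "c k \<in> {1..2}" for k by (rule c)
      show "U \<subseteq> carrier (free_group X)" by (rule U)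
      show "2 \<le> ?s (R 0)" by (rule s2[OF R])
    qed (fact sep piece)+
    show "decomposition_chain ?s R (L.translates (L.lamplighter_slab (carrier (free_group X))))"
      by (rule decomposition_chain_step[where R = R, OF base chain1])
  qed
  then show ?thesis by (simp add: Q)
qed

section \<open>Subexponentiality of the growth function\<close>

lemma subexponentialI:
  assumes mono: "mono_on {0<..} s" and pos: "\<And>x. 0 < x \<Longrightarrow> 1 \<le> s x"
    and bound: "\<And>\<eta>. 0 < \<eta> \<Longrightarrow> \<exists>C>0. \<forall>x>0. real (s x) \<le> C * exp (\<eta> * x)"
  shows "subexponential s"
  unfolding subexponential_def
proof
  show "((\<lambda>x. real (s x) powr (1 / x)) \<longlongrightarrow> 1) at_top"
  proof (rule order_tendstoI)
    fix a :: real assume "a < 1"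
    show "\<forall>\<^sub>F x in at_top. a < real (s x) powr (1 / x)"
      using eventually_gt_at_top[of 0]
    proof eventually_elim
      case (elim x)
      then have "1 \<le> real (s x) powr (1 / x)" using pos[of x] by (intro ge_one_powr_ge_zero) auto
      then show ?case using \<open>a < 1\<close> by simp
    qed
  next
    fix a :: real assume a: "1 < a"
    \<comment> \<open>Half of \<open>ln a\<close> is spent on the exponential rate; the other half
      absorbs \<open>ln C / x\<close> for large \<open>x\<close>.\<close>
    define \<eta> where "\<eta> = ln a / 2"
    have \<eta>: "\<eta> > 0" using a by (simp add: \<eta>_def)
    obtain C where C: "C > 0" "\<And>x. x > 0 \<Longrightarrow> real (s x) \<le> C * exp (\<eta> * x)"
      using bound[OF \<eta>] by blast
    show "\<forall>\<^sub>F x in at_top. real (s x) powr (1 / x) < a"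
      using eventually_gt_at_top[of 0] eventually_gt_at_top[of "ln C / \<eta>"]
    proof eventually_elim
      case (elim x)
      have "real (s x) powr (1 / x) \<le> (C * exp (\<eta> * x)) powr (1 / x)"
        using C(2)[OF elim(1)] elim(1) by (intro powr_mono2) auto
      also have "\<dots> = exp (ln C / x + \<eta>)"
        using C(1) elim(1) by (simp add: powr_def ln_mult add_divide_distrib)
      also have "\<dots> < exp (ln a)"
      proof -
        have "ln C / x < \<eta>" using elim \<eta> by (simp add: field_simps)
        moreover have "ln a = 2 * \<eta>" by (simp add: \<eta>_def)
        ultimately show ?thesis by simp
      qed
      finally show ?case using a by simp
    qed
  qed
qed fact

lemma same_growth_refl: "same_growth s s"
  unfolding same_growth_def by (intro exI[of _ 1]) simp

text \<open>The projections of the generators have norm at most \<open>C\<close>, so the ball of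
  radius \<open>R\<close> projects into the norm ball of radius \<open>C * R\<close>. The count of
  norm balls is then applied with rate \<open>\<eta> / C\<close>.\<close>

lemma Grigorchuk_projection_growth:
  fixes L :: "('a, 'b) monoid_scheme"
  defines "Q \<equiv> L \<times>\<times> Grigorchuk_group"
  assumes L: "group L" and gen: "finite_symmetric_generating_set Q S"
  shows "subexponential (\<lambda>R. card (snd ` word_ball Q S R) + 1)"
proof -
  interpret Q: group Q
    unfolding Q_def by (intro DirProd_group L group_Grigorchuk_group)
  have S: "finite S" "S \<subseteq> carrier Q"
    using gen by (auto simp: finite_symmetric_generating_set_def)
  have sndC: "snd x \<in> carrier Grigorchuk_group" if "x \<in> carrier Q" for x
    using that by (auto simp: Q_def)
  \<comment> \<open>\<open>Suc\<close> keeps \<open>C\<close> positive, so that division by it is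
    meaningful.\<close>
  define C where "C = Suc (Max (insert 0 (grig_norm ` snd ` S)))"
  have CS: "grig_norm (snd x) \<le> C" if "x \<in> S" for x
    using that S by (auto simp: C_def intro!: le_SucI Max_ge)
  have word: "grig_norm (snd (foldr (\<otimes>\<^bsub>Q\<^esub>) w \<one>\<^bsub>Q\<^esub>)) \<le> C * length w" if "set w \<subseteq> S" for w
    using that
  proof (induction w)
    case Nil
    show ?case using grig_norm_id by (simp add: Q_def one_Grigorchuk_group id_def)
  next
    case (Cons x w)
    let ?p = "foldr (\<otimes>\<^bsub>Q\<^esub>) w \<one>\<^bsub>Q\<^esub>"
    have "?p \<in> carrier Q" using Cons.prems S by (intro Q.foldr_mult_closed) auto
    then have p: "snd ?p \<in> carrier Grigorchuk_group" by (rule sndC)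
    have x: "snd x \<in> carrier Grigorchuk_group" using Cons.prems S by (intro sndC) auto
    have eq: "snd (x \<otimes>\<^bsub>Q\<^esub> ?p) = snd x \<circ> snd ?p"
      using mult_Grigorchuk_group[OF x p] by (simp add: Q_def mult_DirProd')
    have "grig_norm (snd x \<circ> snd ?p) \<le> grig_norm (snd x) + grig_norm (snd ?p)"
      using x p unfolding carrier_Grigorchuk_group by (rule grig_norm_comp)
    also have "\<dots> \<le> C + C * length w"
      using CS[of x] Cons by (intro add_mono) simp_all
    finally have "grig_norm (snd (x \<otimes>\<^bsub>Q\<^esub> ?p)) \<le> C + C * length w"
      unfolding eq .
    then show ?case by simp
  qed
  have norm: "real (grig_norm g) \<le> real C * R" if g: "g \<in> snd ` word_ball Q S R" for g R
  proof -
    obtain x where x: "x \<in> carrier Q" "real (word_length Q S x) \<le> R" "g = snd x"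
      using g by (auto simp: word_ball_def)
    obtain w where "set w \<subseteq> S" "length w = word_length Q S x" "foldr (\<otimes>\<^bsub>Q\<^esub>) w \<one>\<^bsub>Q\<^esub> = x"
      using Q.word_length_attained[OF gen x(1)] .
    then have "grig_norm g \<le> C * word_length Q S x" using word[of w] x(3) by simp
    then have "real (grig_norm g) \<le> real C * real (word_length Q S x)"
      by (metis of_nat_mono of_nat_mult)
    also have "\<dots> \<le> real C * R" using x(2) by (intro mult_left_mono) auto
    finally show ?thesis .
  qed
  show ?thesis
  proof (rule subexponentialI)
    show "mono_on {0<..} (\<lambda>R. card (snd ` word_ball Q S R) + 1)"
      using Q.finite_word_ball[OF gen]
      by (intro mono_onI add_mono card_mono image_mono Q.word_ball_mono) auto
    fix \<eta> :: real assume \<eta>: "0 < \<eta>"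
    have "\<eta> / real C > 0" using \<eta> by (simp add: C_def)
    then obtain A where A: "A > 0"
      "\<And>F n. finite F \<Longrightarrow> F \<subseteq> carrier Grigorchuk_group \<Longrightarrow>
         (\<And>g. g \<in> F \<Longrightarrow> real (grig_norm g) \<le> n) \<Longrightarrow> real (card F) \<le> A * exp (\<eta> / real C * n)"
      using grig_ball_card by metis
    show "\<exists>B>0. \<forall>x>0. real (card (snd ` word_ball Q S x) + 1) \<le> B * exp (\<eta> * x)"
    \<comment> \<open>The additional 1 absorbs the extra colour, because the exponential is at least
      1.\<close>
    proof (intro exI[of _ "A + 1"] conjI allI impI)
      show "0 < A + 1" using A by simp
      fix x :: real assume x: "0 < x"
      have "real (card (snd ` word_ball Q S x)) \<le> A * exp (\<eta> / real C * (real C * x))"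
        using Q.finite_word_ball[OF gen] sndC norm
        by (intro A(2)) (auto simp: word_ball_def)
      also have "\<dots> = A * exp (\<eta> * x)" by (simp add: C_def)
      finally have "real (card (snd ` word_ball Q S x)) \<le> A * exp (\<eta> * x)" .
      moreover have "1 \<le> exp (\<eta> * x)" using \<eta> x by simp
      ultimately show "real (card (snd ` word_ball Q S x) + 1) \<le> (A + 1) * exp (\<eta> * x)"
        by (simp only: distrib_right of_nat_add of_nat_1 mult_1)
    qed
  qed auto
qed

theorem theorem5p1:
  shows "(\<exists>S. finite_symmetric_generating_set ((integer_group wr F2) \<times>\<times> Grigorchuk_group) S) \<and>
         (\<forall>S. finite_symmetric_generating_set ((integer_group wr F2) \<times>\<times> Grigorchuk_group) S \<longrightarrow>
            subexponential_decomposition_growth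
              (word_metric ((integer_group wr F2) \<times>\<times> Grigorchuk_group) S))"
proof (intro conjI allI impI)
  interpret lamplighter_times_group F2 Grigorchuk_group
    unfolding F2_def
    by (intro lamplighter_times_group.intro group_free_group group_Grigorchuk_group)
  have "{grig_a, grig_b, grig_c, grig_d} \<subseteq> carrier Grigorchuk_group"
    using generate.incl[of _ "{grig_a, grig_b, grig_c, grig_d}" Grigorchuk_group]
    unfolding generate_Grigorchuk_group by blast
  moreover have "(\<lambda>l. [l]) ` ({0, 1} \<times> UNIV) \<subseteq> carrier F2"
    by (auto simp: F2_def free_group_def)
  moreover have "generate F2 ((\<lambda>l. [l]) ` ({0, 1} \<times> UNIV)) = carrier F2"
    unfolding F2_def by (rule generate_free_group)
  ultimately have "\<exists>S. finite_symmetric_generating_set Q S"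
    by (intro ex_finite_symmetric_generating_set_Q[OF _ _ _ _ _ generate_Grigorchuk_group]) auto
  then show "\<exists>S. finite_symmetric_generating_set ((integer_group wr F2) \<times>\<times> Grigorchuk_group) S"
    by (simp add: Q_def)
next
  fix S assume gen: "finite_symmetric_generating_set ((integer_group wr F2) \<times>\<times> Grigorchuk_group) S"
  have wr: "group (integer_group wr F2)"
    unfolding F2_def by (intro group_wreath_product group_integer_group group_free_group)
  have "decomposition_growth_function (word_metric ((integer_group wr F2) \<times>\<times> Grigorchuk_group) S)
      (\<lambda>R. card (snd ` word_ball ((integer_group wr F2) \<times>\<times> Grigorchuk_group) S R) + 1)"
    unfolding F2_def
    by (rule free_lamplighter_growth_function) (use gen group_Grigorchuk_group in \<open>simp_all add: F2_def\<close>)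
  \<comment> \<open>The growth function is itself subexponential, so it is compared with
    itself.\<close>
  then show "subexponential_decomposition_growth
      (word_metric ((integer_group wr F2) \<times>\<times> Grigorchuk_group) S)"
    using Grigorchuk_projection_growth[OF wr gen] same_growth_refl
    unfolding subexponential_decomposition_growth_def by blast
qed

end
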